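(* Let $R$ be a (not necessarily commutative) ring and $\mathcal{C}$ a class of (left) $R$-modules which is closed under finite direct sums, direct summands, and isomorphisms. Suppose that all modules in $\mathcal{C}$ are directly finite and that there are, up to isomorphism, only finitely many indecomposable modules in $\mathcal{C}$. Then $\mathcal{L}(\mathcal{V}(\mathcal{C}))$ satisfies the Structure Theorem for Unions.
   Context: $\mathbb{N}$ is the set of positive integers, $\mathbb{N}_0=\mathbb{N}\cup\{0\}$. A module $M$ is directly finite if $M\cong M\oplus N$ implies $N=0$. $\mathcal{V}(\mathcal{C})$ is a set of representatives of the isomorphism classes of modules in $\mathcal{C}$, made into a reduced commutative semigroup by $[M]+[N]=[M\oplus N]$, with identity the class of the zero module; its irreducible elements (atoms) are the classes of indecomposable modules. For a non-zero $[M]\in\mathcal{V}(\mathcal{C})$, $\mathsf{L}([M])\subseteq\mathbb{N}$ is the set of all $k$ such that $M$ is isomorphic to a direct sum of $k$ indecomposable modules; $\mathsf{L}([0])=\{0\}$. $\mathcal{L}(\mathcal{V}(\mathcal{C}))=\{\mathsf{L}(a):a\in\mathcal{V}(\mathcal{C})\}$, and for $k\in\mathbb{N}$, $\mathcal{U}_k$ is the union of all $L\in\mathcal{L}(\mathcal{V}(\mathcal{C}))$ with $k\in L$ (if $\mathcal{V}(\mathcal{C})$ is trivial, $\mathcal{U}_k=\{k\}$ by convention). For $L\subseteq\mathbb{N}_0$, $\Delta(L)$ is the set of all $d\in\mathbb{N}$ such that there are $k,\ell\in L$ with $\ell-k=d$ and no element of $L$ strictly between $k$ and $\ell$. $L$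 is an AP with difference $d\in\mathbb{N}$ if $L\ne\emptyset$ and $\Delta(L)\subseteq\{d\}$. $L$ is an AAP with difference $d$ and bound $M\in\mathbb{N}_0$ if $L\subseteq y+d\mathbb{Z}$ for some $y\in\mathbb{Z}$ and $\{x\in L:\inf L+M\le x\le\sup L-M\}$ is an AP with difference $d$. $\mathcal{L}(\mathcal{V}(\mathcal{C}))$ satisfies the Structure Theorem for Unions if there are $d\in\mathbb{N}$, $M\in\mathbb{N}_0$ such that $\mathcal{U}_k$ is an AAP with difference $d$ and bound $M$ for all sufficiently large $k\in\mathbb{N}$.
   Formalization: It is additionally assumed that if the class contains a non-zero module, then it contains an indecomposable one; otherwise every U_k is empty and the claim fails (e.g. finitely generated projectives over an atomless Boolean ring). *)

theory Defs
  imports "HOL-Algebra.Module" "HOL-Library.FuncSet" "HOL-Library.Extended_Nat"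
begin

section \<open>Left modules over a not necessarily commutative ring\<close>

text \<open>
  The locale \<^locale>\<open>module\<close> of the library requires a commutative ring of scalars. The axioms
  below are the same ones over an arbitrary (unital) ring. The record type
  \<^typ>\<open>('a, 'b) module\<close> is reused; its multiplicative fields carry no information for a module.
\<close>

locale left_module = R?: ring R + M?: abelian_group M
  for R (structure) and M (structure) +
  assumes smult_closed:
      "\<lbrakk> a \<in> carrier R; x \<in> carrier M \<rbrakk> \<Longrightarrow> a \<odot>\<^bsub>M\<^esub> x \<in> carrier M"
    and smult_l_distr:
      "\<lbrakk> a \<in> carrier R; b \<in> carrier R; x \<in> carrier M \<rbrakk> \<Longrightarrow>
       (a \<oplus> b) \<odot>\<^bsub>M\<^esub> x = a \<odot>\<^bsub>M\<^esub> x \<oplus>\<^bsub>M\<^esub> b \<odot>\<^bsub>M\<^esub> x"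
    and smult_r_distr:
      "\<lbrakk> a \<in> carrier R; x \<in> carrier M; y \<in> carrier M \<rbrakk> \<Longrightarrow>
       a \<odot>\<^bsub>M\<^esub> (x \<oplus>\<^bsub>M\<^esub> y) = a \<odot>\<^bsub>M\<^esub> x \<oplus>\<^bsub>M\<^esub> a \<odot>\<^bsub>M\<^esub> y"
    and smult_assoc1:
      "\<lbrakk> a \<in> carrier R; b \<in> carrier R; x \<in> carrier M \<rbrakk> \<Longrightarrow>
       (a \<otimes> b) \<odot>\<^bsub>M\<^esub> x = a \<odot>\<^bsub>M\<^esub> (b \<odot>\<^bsub>M\<^esub> x)"
    and smult_one:
      "x \<in> carrier M \<Longrightarrow> \<one> \<odot>\<^bsub>M\<^esub> x = x"

definition module_iso ::
  "('a, 'r) ring_scheme \<Rightarrow> ('a, 'b) module \<Rightarrow> ('a, 'c) module \<Rightarrow> bool" where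
  "module_iso R M N \<longleftrightarrow>
     (\<exists>f. bij_betw f (carrier M) (carrier N) \<and>
          (\<forall>x\<in>carrier M. \<forall>y\<in>carrier M. f (x \<oplus>\<^bsub>M\<^esub> y) = f x \<oplus>\<^bsub>N\<^esub> f y) \<and>
          (\<forall>a\<in>carrier R. \<forall>x\<in>carrier M. f (a \<odot>\<^bsub>M\<^esub> x) = a \<odot>\<^bsub>N\<^esub> f x))"

definition zero_module :: "('a, 'b) module \<Rightarrow> bool" where
  "zero_module M \<longleftrightarrow> carrier M = {\<zero>\<^bsub>M\<^esub>}"

definition direct_sum :: "('a, 'b) module \<Rightarrow> ('a, 'c) module \<Rightarrow> ('a, 'b \<times> 'c) module" where
  "direct_sum M N =
     \<lparr> carrier = carrier M \<times> carrier N,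
       mult = undefined, one = undefined,
       zero = (\<zero>\<^bsub>M\<^esub>, \<zero>\<^bsub>N\<^esub>),
       add = (\<lambda>(x, y) (x', y'). (x \<oplus>\<^bsub>M\<^esub> x', y \<oplus>\<^bsub>N\<^esub> y')),
       smult = (\<lambda>a (x, y). (a \<odot>\<^bsub>M\<^esub> x, a \<odot>\<^bsub>N\<^esub> y)) \<rparr>"

text \<open>The direct sum of \<open>F 0, \<dots>, F (k - 1)\<close>; for \<open>k = 0\<close> it is a zero module.\<close>

definition finite_direct_sum :: "nat \<Rightarrow> (nat \<Rightarrow> ('a, 'b) module) \<Rightarrow> ('a, nat \<Rightarrow> 'b) module" where
  "finite_direct_sum k F =
     \<lparr> carrier = (\<Pi>\<^sub>E i\<in>{..<k}. carrier (F i)),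
       mult = undefined, one = undefined,
       zero = (\<lambda>i\<in>{..<k}. \<zero>\<^bsub>F i\<^esub>),
       add = (\<lambda>x y. \<lambda>i\<in>{..<k}. x i \<oplus>\<^bsub>F i\<^esub> y i),
       smult = (\<lambda>a x. \<lambda>i\<in>{..<k}. a \<odot>\<^bsub>F i\<^esub> x i) \<rparr>"

text \<open>
  In the next two definitions it is enough to let \<open>N\<close> and \<open>N'\<close> range over modules with elements
  in the same type as those of \<open>M\<close>, because a direct summand of \<open>M\<close> is isomorphic to a
  submodule of \<open>M\<close>.
\<close>

definition indecomposable :: "('a, 'r) ring_scheme \<Rightarrow> ('a, 'b) module \<Rightarrow> bool" where
  "indecomposable R M \<longleftrightarrow>
     left_module R M \<and> \<not> zero_module M \<and>
     (\<forall>(N :: ('a, 'b) module) (N' :: ('a, 'b) module). left_module R N \<longrightarrow> left_module R N' \<longrightarrow>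
        module_iso R M (direct_sum N N') \<longrightarrow> zero_module N \<or> zero_module N')"

definition directly_finite :: "('a, 'r) ring_scheme \<Rightarrow> ('a, 'b) module \<Rightarrow> bool" where
  "directly_finite R M \<longleftrightarrow>
     (\<forall>N :: ('a, 'b) module. left_module R N \<longrightarrow>
        module_iso R M (direct_sum M N) \<longrightarrow> zero_module N)"


section \<open>Classes of modules\<close>

text \<open>
  A class of modules is a set \<open>C\<close> of modules with elements in an arbitrary type \<open>'b\<close>. Any class
  whose isomorphism classes have a set of representatives is of this form, up to isomorphism,
  for a sufficiently large type \<open>'b\<close>. A direct sum of modules in \<open>C\<close> lives in another type, so
  closure under direct sums says that it is isomorphic to a member of \<open>C\<close>. The case \<open>k = 0\<close> puts
  a zero module into \<open>C\<close>.
\<close>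

definition closed_under_finite_direct_sums ::
  "('a, 'r) ring_scheme \<Rightarrow> ('a, 'b) module set \<Rightarrow> bool" where
  "closed_under_finite_direct_sums R C \<longleftrightarrow>
     (\<forall>k F. (\<forall>i<k. F i \<in> C) \<longrightarrow> (\<exists>P\<in>C. module_iso R P (finite_direct_sum k F)))"

definition closed_under_direct_summands ::
  "('a, 'r) ring_scheme \<Rightarrow> ('a, 'b) module set \<Rightarrow> bool" where
  "closed_under_direct_summands R C \<longleftrightarrow>
     (\<forall>M\<in>C. \<forall>(N :: ('a, 'b) module) (N' :: ('a, 'b) module). left_module R N \<longrightarrow> left_module R N' \<longrightarrow>
        module_iso R M (direct_sum N N') \<longrightarrow> N \<in> C)"

definition closed_under_isomorphisms ::
  "('a, 'r) ring_scheme \<Rightarrow> ('a, 'b) module set \<Rightarrow> bool" where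
  "closed_under_isomorphisms R C \<longleftrightarrow>
     (\<forall>M\<in>C. \<forall>N :: ('a, 'b) module. left_module R N \<longrightarrow> module_iso R M N \<longrightarrow> N \<in> C)"

definition iso_class ::
  "('a, 'r) ring_scheme \<Rightarrow> ('a, 'b) module set \<Rightarrow> ('a, 'b) module \<Rightarrow> ('a, 'b) module set" where
  "iso_class R C M = {N \<in> C. module_iso R N M}"

text \<open>
  The semigroup of isomorphism classes of modules in \<open>C\<close>, written multiplicatively as a record
  of type \<^typ>\<open>'c monoid\<close>. Its elements are the isomorphism classes themselves instead of chosen
  representatives.
\<close>

definition V_monoid ::
  "('a, 'r) ring_scheme \<Rightarrow> ('a, 'b) module set \<Rightarrow> ('a, 'b) module set monoid" where
  "V_monoid R C =
     \<lparr> carrier = iso_class R C ` C,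
       mult = (\<lambda>A B. {P \<in> C. \<exists>M\<in>A. \<exists>N\<in>B. module_iso R P (direct_sum M N)}),
       one = {M \<in> C. zero_module M} \<rparr>"


section \<open>Sets of lengths and their unions\<close>

definition set_of_lengths ::
  "('a, 'r) ring_scheme \<Rightarrow> ('a, 'b) module set \<Rightarrow> ('a, 'b) module set \<Rightarrow> nat set" where
  "set_of_lengths R C A =
     (if A = \<one>\<^bsub>V_monoid R C\<^esub> then {0}
      else {k. 1 \<le> k \<and> (\<exists>M\<in>A. \<exists>F :: nat \<Rightarrow> ('a, 'b) module.
              (\<forall>i<k. indecomposable R (F i)) \<and> module_iso R M (finite_direct_sum k F))})"

definition system_of_sets_of_lengths ::
  "('a, 'r) ring_scheme \<Rightarrow> ('a, 'b) module set \<Rightarrow> nat set set" where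
  "system_of_sets_of_lengths R C = set_of_lengths R C ` carrier (V_monoid R C)"

definition union_of_sets_of_lengths ::
  "('a, 'r) ring_scheme \<Rightarrow> ('a, 'b) module set \<Rightarrow> nat \<Rightarrow> nat set" where
  "union_of_sets_of_lengths R C k =
     (if carrier (V_monoid R C) = {\<one>\<^bsub>V_monoid R C\<^esub>} then {k}
      else \<Union> {L \<in> system_of_sets_of_lengths R C. k \<in> L})"

definition set_of_distances :: "nat set \<Rightarrow> nat set" where
  "set_of_distances L =
     {d. 1 \<le> d \<and> (\<exists>k\<in>L. \<exists>l\<in>L. l - k = d \<and> \<not> (\<exists>m\<in>L. k < m \<and> m < l))}"

definition is_AP :: "nat set \<Rightarrow> nat \<Rightarrow> bool" where
  "is_AP L d \<longleftrightarrow> L \<noteq> {} \<and> set_of_distances L \<subseteq> {d}"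

text \<open>
  The infimum and supremum are taken in \<^typ>\<open>enat\<close>, so that the supremum of an infinite set is
  \<open>\<infinity>\<close>. The bound \<open>x \<le> sup L - b\<close> is written \<open>x + b \<le> sup L\<close> to avoid truncated subtraction.
\<close>

definition is_AAP :: "nat set \<Rightarrow> nat \<Rightarrow> nat \<Rightarrow> bool" where
  "is_AAP L d b \<longleftrightarrow>
     (\<exists>y::int. \<forall>x\<in>L. \<exists>z::int. int x = y + int d * z) \<and>
     is_AP {x \<in> L. Inf (enat ` L) + enat b \<le> enat x \<and> enat x + enat b \<le> Sup (enat ` L)} d"

definition structure_theorem_for_unions ::
  "('a, 'r) ring_scheme \<Rightarrow> ('a, 'b) module set \<Rightarrow> bool" where
  "structure_theorem_for_unions R C \<longleftrightarrow>
     (\<exists>d b. 1 \<le> d \<and> (\<exists>k0. \<forall>k\<ge>k0. 1 \<le> k \<longrightarrow> is_AAP (union_of_sets_of_lengths R C k) d b))"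

text \<open>
  The empty set is not an arithmetical progression. Hence the structure theorem fails, for a
  trivial reason, if \<open>C\<close> contains non-zero modules but no indecomposable one. An example is the
  class of finitely generated projective modules over an atomless Boolean ring.
\<close>

lemma summand_of_finite_direct_sum_mem:
  fixes R :: "('a, 'r) ring_scheme" and C :: "('a, 'b) module set"
  assumes summands: "closed_under_direct_summands R C"
    and M: "M \<in> C" "left_module R M"
    and F: "\<forall>i<k. left_module R (F i)" and k: "1 \<le> k"
    and iso: "module_iso R M (finite_direct_sum k F)"
  shows "F 0 \<in> C"
proof -
  interpret M: left_module R M by fact
  interpret F0: left_module R "F 0" using F k by auto
  define S where "S = finite_direct_sum k F"
  obtain f where bij: "bij_betw f (carrier M) (carrier S)"
    and add: "\<And>x y. x \<in> carrier M \<Longrightarrow> y \<in> carrier M \<Longrightarrow> f (x \<oplus>\<^bsub>M\<^esub> y) = f x \<oplus>\<^bsub>S\<^esub> f y"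
    and smult: "\<And>a x. a \<in> carrier R \<Longrightarrow> x \<in> carrier M \<Longrightarrow> f (a \<odot>\<^bsub>M\<^esub> x) = a \<odot>\<^bsub>S\<^esub> f x"
    using iso unfolding module_iso_def S_def by blast
  define g where "g = inv_into (carrier M) f"
  have f_in: "f x \<in> carrier S" if "x \<in> carrier M" for x
    using bij that by (auto simp: bij_betw_def)
  have fi: "f x i \<in> carrier (F i)" if "x \<in> carrier M" "i < k" for x i
    using f_in[OF that(1)] that(2) by (auto simp: S_def finite_direct_sum_def)
  have g_in: "g s \<in> carrier M" and fg: "f (g s) = s" if "s \<in> carrier S" for s
    using bij that unfolding g_def bij_betw_def by (auto simp: inv_into_into f_inv_into_f)
  have inj: "x = y" if "x \<in> carrier M" "y \<in> carrier M" "f x = f y" for x y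
    using bij that by (auto simp: bij_betw_def inj_on_def)
  have eqS: "s = t" if "s \<in> carrier S" "t \<in> carrier S" "\<And>i. i < k \<Longrightarrow> s i = t i" for s t
    using that by (auto simp: S_def finite_direct_sum_def intro: PiE_ext)
  have addi: "f (x \<oplus>\<^bsub>M\<^esub> y) i = f x i \<oplus>\<^bsub>F i\<^esub> f y i"
    if "x \<in> carrier M" "y \<in> carrier M" "i < k" for x y i
    using add[OF that(1,2)] that(3) by (simp add: S_def finite_direct_sum_def)
  have smulti: "f (a \<odot>\<^bsub>M\<^esub> x) i = a \<odot>\<^bsub>F i\<^esub> f x i"
    if "a \<in> carrier R" "x \<in> carrier M" "i < k" for a x i
    using smult[OF that(1,2)] that(3) by (simp add: S_def finite_direct_sum_def)
  have ab: "abelian_group (F i)" if "i < k" for i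
    using F that by (auto simp: left_module_def)
  have zeroi: "f \<zero>\<^bsub>M\<^esub> i = \<zero>\<^bsub>F i\<^esub>" if "i < k" for i
  proof -
    interpret Fi: abelian_group "F i" by (rule ab[OF that])
    have "f \<zero>\<^bsub>M\<^esub> i \<oplus>\<^bsub>F i\<^esub> f \<zero>\<^bsub>M\<^esub> i = f \<zero>\<^bsub>M\<^esub> i"
      using addi[of "\<zero>\<^bsub>M\<^esub>" "\<zero>\<^bsub>M\<^esub>" i] that by simp
    thus ?thesis using fi[of "\<zero>\<^bsub>M\<^esub>" i] that
      by (metis Fi.add.l_cancel_one' Fi.r_zero Fi.zero_closed M.M.zero_closed)
  qed
  have smult_zero: "a \<odot>\<^bsub>F 0\<^esub> \<zero>\<^bsub>F 0\<^esub> = \<zero>\<^bsub>F 0\<^esub>" if "a \<in> carrier R" for a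
  proof -
    have "a \<odot>\<^bsub>F 0\<^esub> \<zero>\<^bsub>F 0\<^esub> \<oplus>\<^bsub>F 0\<^esub> a \<odot>\<^bsub>F 0\<^esub> \<zero>\<^bsub>F 0\<^esub> = a \<odot>\<^bsub>F 0\<^esub> \<zero>\<^bsub>F 0\<^esub>"
      using F0.smult_r_distr[OF that F0.M.zero_closed F0.M.zero_closed] by simp
    thus ?thesis using F0.smult_closed[OF that F0.M.zero_closed]
      by (metis F0.M.add.l_cancel_one' F0.M.r_zero F0.M.zero_closed)
  qed
  define N where "N = M \<lparr>carrier := {x \<in> carrier M. f x 0 = \<zero>\<^bsub>F 0\<^esub>}\<rparr>"
  have k0: "0 < k" using k by simp
  have N_simps: "carrier N = {x \<in> carrier M. f x 0 = \<zero>\<^bsub>F 0\<^esub>}" "add N = add M"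
    "zero N = zero M" "smult N = smult M"
    by (simp_all add: N_def)
  have neg: "\<exists>y\<in>carrier N. y \<oplus>\<^bsub>M\<^esub> x = \<zero>\<^bsub>M\<^esub>" if x: "x \<in> carrier N" for x
  proof -
    have xM: "x \<in> carrier M" using x by (simp add: N_simps)
    have "f (\<ominus>\<^bsub>M\<^esub> x) 0 \<oplus>\<^bsub>F 0\<^esub> f x 0 = \<zero>\<^bsub>F 0\<^esub>"
      using addi[of "\<ominus>\<^bsub>M\<^esub> x" x 0] xM k0 zeroi[OF k0] by (simp add: M.M.l_neg)
    hence "f (\<ominus>\<^bsub>M\<^esub> x) 0 = \<zero>\<^bsub>F 0\<^esub>" using x xM fi[of "\<ominus>\<^bsub>M\<^esub> x" 0] k0
      by (simp add: N_simps)
    thus ?thesis using xM by (intro bexI[of _ "\<ominus>\<^bsub>M\<^esub> x"]) (auto simp: N_simps M.M.l_neg)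
  qed
  have "abelian_group N"
    by (rule abelian_groupI)
      (use neg in \<open>auto simp: N_simps addi[OF _ _ k0] zeroi[OF k0] M.M.a_ac\<close>)
  hence N: "left_module R N"
    by (auto intro!: left_module.intro left_module_axioms.intro M.R.ring_axioms
        simp: N_simps M.smult_closed M.smult_l_distr M.smult_r_distr M.smult_assoc1 M.smult_one
          smulti[OF _ _ k0] smult_zero)
  define p where "p x = (f x)(0 := \<zero>\<^bsub>F 0\<^esub>)" for x
  have p_i: "p x i = (if i = 0 then \<zero>\<^bsub>F 0\<^esub> else f x i)" for x i
    by (simp add: p_def)
  have p_in: "p x \<in> carrier S" if "x \<in> carrier M" for x
    using f_in[OF that] k0 by (auto simp: p_def S_def finite_direct_sum_def PiE_iff extensional_def)
  define h where "h x = (f x 0, g (p x))" for x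
  have gp: "g (p x) \<in> carrier N" "g (p x) \<in> carrier M" if "x \<in> carrier M" for x
    using g_in[OF p_in[OF that]] fg[OF p_in[OF that]] by (auto simp: N_simps p_def)
  have fgp: "f (g (p x)) = p x" if "x \<in> carrier M" for x
    using fg[OF p_in[OF that]] .
  have "bij_betw h (carrier M) (carrier (direct_sum (F 0) N))"
  proof (rule bij_betw_imageI)
    show "inj_on h (carrier M)"
    proof (rule inj_onI)
      fix x y assume xy: "x \<in> carrier M" "y \<in> carrier M" "h x = h y"
      have eq: "f x 0 = f y 0" "g (p x) = g (p y)" using xy(3) by (simp_all add: h_def)
      have "p x = p y" using fgp[OF xy(1)] fgp[OF xy(2)] unfolding eq(2) by (rule trans[OF sym])
      moreover note eq(1)
      ultimately have "f x = f y" unfolding p_def by (metis fun_upd_triv fun_upd_upd)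
      thus "x = y" using inj xy by blast
    qed
    show "h ` carrier M = carrier (direct_sum (F 0) N)"
    proof (intro equalityI subsetI)
      fix z assume "z \<in> h ` carrier M"
      then obtain x where "x \<in> carrier M" "z = h x" by blast
      thus "z \<in> carrier (direct_sum (F 0) N)"
        using gp(1) fi k0 by (simp add: h_def direct_sum_def)
    next
      fix z assume "z \<in> carrier (direct_sum (F 0) N)"
      then obtain u n where z: "z = (u, n)" "u \<in> carrier (F 0)" "n \<in> carrier N"
        by (auto simp: direct_sum_def)
      have n: "n \<in> carrier M" "f n 0 = \<zero>\<^bsub>F 0\<^esub>" using z by (auto simp: N_simps)
      define s where "s = (f n)(0 := u)"
      have s: "s \<in> carrier S" using f_in[OF n(1)] z(2) k0
        by (auto simp: s_def S_def finite_direct_sum_def PiE_iff extensional_def)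
      have "p (g s) = f n" using fg[OF s] n(2) by (auto simp: p_def s_def)
      hence "g (p (g s)) = n"
        using inj[OF g_in[OF f_in[OF n(1)]] n(1)] fg[OF f_in[OF n(1)]] by simp
      hence "h (g s) = z" using fg[OF s] by (simp add: h_def z s_def)
      thus "z \<in> h ` carrier M" using g_in[OF s] by blast
    qed
  qed
  moreover have "h (x \<oplus>\<^bsub>M\<^esub> y) = h x \<oplus>\<^bsub>direct_sum (F 0) N\<^esub> h y"
    if xy: "x \<in> carrier M" "y \<in> carrier M" for x y
  proof -
    have xy': "x \<oplus>\<^bsub>M\<^esub> y \<in> carrier M" "g (p x) \<oplus>\<^bsub>M\<^esub> g (p y) \<in> carrier M"
      using xy gp by simp_all
    have "f (g (p (x \<oplus>\<^bsub>M\<^esub> y))) = f (g (p x) \<oplus>\<^bsub>M\<^esub> g (p y))"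
    proof (rule eqS[OF f_in[OF gp(2)[OF xy'(1)]] f_in[OF xy'(2)]])
      fix i assume "i < k"
      thus "f (g (p (x \<oplus>\<^bsub>M\<^esub> y))) i = f (g (p x) \<oplus>\<^bsub>M\<^esub> g (p y)) i"
        using xy gp(2) by (simp add: addi fgp[OF xy'(1)] fgp p_i)
    qed
    hence "g (p (x \<oplus>\<^bsub>M\<^esub> y)) = g (p x) \<oplus>\<^bsub>M\<^esub> g (p y)"
      by (rule inj[OF gp(2)[OF xy'(1)] xy'(2)])
    thus ?thesis using xy k0 by (simp add: h_def direct_sum_def N_simps addi)
  qed
  moreover have "h (a \<odot>\<^bsub>M\<^esub> x) = a \<odot>\<^bsub>direct_sum (F 0) N\<^esub> h x"
    if ax: "a \<in> carrier R" "x \<in> carrier M" for a x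
  proof -
    have ax': "a \<odot>\<^bsub>M\<^esub> x \<in> carrier M" "a \<odot>\<^bsub>M\<^esub> g (p x) \<in> carrier M"
      using ax gp by (simp_all add: M.smult_closed)
    have "f (g (p (a \<odot>\<^bsub>M\<^esub> x))) = f (a \<odot>\<^bsub>M\<^esub> g (p x))"
    proof (rule eqS[OF f_in[OF gp(2)[OF ax'(1)]] f_in[OF ax'(2)]])
      fix i assume "i < k"
      thus "f (g (p (a \<odot>\<^bsub>M\<^esub> x))) i = f (a \<odot>\<^bsub>M\<^esub> g (p x)) i"
        using ax gp(2) by (simp add: smulti fgp[OF ax'(1)] fgp p_i smult_zero)
    qed
    hence "g (p (a \<odot>\<^bsub>M\<^esub> x)) = a \<odot>\<^bsub>M\<^esub> g (p x)"
      by (rule inj[OF gp(2)[OF ax'(1)] ax'(2)])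
    thus ?thesis using ax k0 by (simp add: h_def direct_sum_def N_simps smulti)
  qed
  ultimately have "module_iso R M (direct_sum (F 0) N)"
    unfolding module_iso_def by blast
  thus ?thesis
    using summands M N F k0 unfolding closed_under_direct_summands_def by blast
qed

lemma structure_theorem_fails_without_indecomposables:
  fixes R :: "('a, 'r) ring_scheme" and C :: "('a, 'b) module set"
  assumes modules: "\<forall>M\<in>C. left_module R M"
    and summands: "closed_under_direct_summands R C"
    and nonzero: "M \<in> C" "\<not> zero_module M"
    and none: "\<not> (\<exists>N\<in>C. indecomposable R N)"
  shows "\<not> structure_theorem_for_unions R C"
proof
  assume "structure_theorem_for_unions R C"
  then obtain d b k0 where
    *: "\<And>k. k \<ge> k0 \<Longrightarrow> 1 \<le> k \<Longrightarrow> is_AAP (union_of_sets_of_lengths R C k) d b"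
    unfolding structure_theorem_for_unions_def by blast
  have "module_iso R M M"
    unfolding module_iso_def by (rule exI[of _ id]) (auto simp: bij_betw_def)
  hence "M \<in> iso_class R C M" "iso_class R C M \<in> carrier (V_monoid R C)"
    using nonzero by (auto simp: iso_class_def V_monoid_def)
  moreover have "M \<notin> \<one>\<^bsub>V_monoid R C\<^esub>"
    using nonzero by (simp add: V_monoid_def)
  ultimately have "carrier (V_monoid R C) \<noteq> {\<one>\<^bsub>V_monoid R C\<^esub>}" by auto
  moreover have "k \<notin> set_of_lengths R C A" if k: "1 \<le> k" and A: "A \<in> carrier (V_monoid R C)"
    for k A
  proof
    assume "k \<in> set_of_lengths R C A"
    then obtain N F where N: "N \<in> A" and F: "\<forall>i<k. indecomposable R (F i)"
      and iso: "module_iso R N (finite_direct_sum k (F :: nat \<Rightarrow> ('a, 'b) module))"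
      using k by (auto simp: set_of_lengths_def split: if_splits)
    have "N \<in> C" using N A by (auto simp: V_monoid_def iso_class_def)
    hence "F 0 \<in> C"
      using summand_of_finite_direct_sum_mem[OF summands _ _ _ k iso] modules F
      by (auto simp: indecomposable_def)
    thus False using none F k by auto
  qed
  ultimately have "union_of_sets_of_lengths R C (max 1 k0) = {}"
    by (auto simp: union_of_sets_of_lengths_def system_of_sets_of_lengths_def)
  with *[of "max 1 k0"] show False by (simp add: is_AAP_def is_AP_def)
qed

end

theory Submission
  imports Defs "HOL-Library.Multiset" "HOL-Combinatorics.List_Permutation"
begin

text \<open>
  Write \<open>x \<sim> y\<close> if the multisets \<open>x\<close>, \<open>y\<close> of isomorphism classes of indecomposable modules have
  isomorphic direct sums. Direct finiteness says that \<open>x \<sim> x + y\<close> forces \<open>y = 0\<close>, and this passes to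
  the cancellative hull of the congruence: \<open>x \<approx> y\<close> iff \<open>x + z \<sim> y + z\<close> for some \<open>z\<close>. The pairs
  \<open>x \<approx> y\<close> are closed under differences, so by Dickson's lemma they are sums of finitely many minimal
  ones, and the ratio \<open>|y| / |x|\<close> attains its maximum at some \<open>u \<approx> v\<close>. From \<open>u + z \<sim> v + z\<close> one gets
  \<open>m u + z \<sim> m v + z\<close> for all \<open>m\<close>.

  Now let \<open>T\<close> be the additive, symmetric set of pairs \<open>(|x|, |y|)\<close> with \<open>x \<sim> y\<close>. It contains
  \<open>(1, 1)\<close>, lies in the cone of slopes at most \<open>|v| / |u|\<close>, and contains the ray
  \<open>m (|u|, |v|) + (|z|, |z|)\<close>. With \<open>d\<close> the least positive difference \<open>l - k\<close> in \<open>T\<close>, every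
  \<open>(k, l)\<close> with \<open>d\<close> dividing \<open>l - k\<close> that is far enough inside the cone is a sum of a point of the
  ray, fewer than \<open>(|v| - |u|) / d\<close> copies of a pair \<open>(k\<^sub>1, k\<^sub>1 + d)\<close>, and a multiple of \<open>(1, 1)\<close>.
\<close>

section \<open>Almost arithmetical progressions\<close>

text \<open>An infimum of a non-empty set in \<open>enat\<close> is attained, so comparing with it
  amounts to comparing with a member of \<open>U\<close>. Together with the next lemma this
  eliminates \<open>enat\<close> from \<open>is_AAP\<close>.\<close>

lemma Inf_enat_add_le_iff:
  assumes "U \<noteq> {}"
  shows "Inf (enat ` U) + enat b \<le> enat x \<longleftrightarrow> (\<exists>l\<in>U. l + b \<le> x)"
proof
  assume *: "Inf (enat ` U) + enat b \<le> enat x"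
  have "Inf (enat ` U) \<in> enat ` U" using assms wellorder_InfI[of _ "enat ` U"] by blast
  then obtain l where "l \<in> U" "Inf (enat ` U) = enat l" by auto
  thus "\<exists>l\<in>U. l + b \<le> x" using * by auto
next
  assume "\<exists>l\<in>U. l + b \<le> x"
  then obtain l where l: "l \<in> U" "l + b \<le> x" by blast
  have "Inf (enat ` U) + enat b \<le> enat l + enat b"
    using l by (intro add_right_mono Inf_lower) auto
  also have "\<dots> \<le> enat x" using l by simp
  finally show "Inf (enat ` U) + enat b \<le> enat x" .
qed

text \<open>Only finite \<open>n\<close> are compared, so an infinite supremum does no harm: if all
  members were below \<open>n\<close>, then \<open>n - 1\<close> would be an upper bound, and
  \<open>0 < n\<close> because \<open>U\<close> has a member.\<close>

lemma le_Sup_enat_iff: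
  assumes "U \<noteq> {}"
  shows "enat n \<le> Sup (enat ` U) \<longleftrightarrow> (\<exists>l\<in>U. n \<le> l)"
proof
  assume *: "enat n \<le> Sup (enat ` U)"
  show "\<exists>l\<in>U. n \<le> l"
  proof (rule ccontr)
    assume "\<not> (\<exists>l\<in>U. n \<le> l)"
    hence less: "l < n" if "l \<in> U" for l using that by auto
    hence "0 < n" using assms by fastforce
    have "Sup (enat ` U) \<le> enat (n - 1)"
      using less by (intro Sup_least) fastforce
    hence "enat n \<le> enat (n - 1)" using * by (rule order_trans[rotated])
    thus False using \<open>0 < n\<close> by simp
  qed
next
  assume "\<exists>l\<in>U. n \<le> l"
  then obtain l where l: "l \<in> U" "n \<le> l" by blast
  hence "enat l \<le> Sup (enat ` U)" by (intro Sup_upper) auto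
  thus "enat n \<le> Sup (enat ` U)" using l by (metis enat_ord_simps(1) order_trans)
qed

text \<open>If consecutive members \<open>x < y\<close> of the central part differed by more than
  \<open>d\<close>, then \<open>fill\<close> would put \<open>x + d\<close> between them. The
  members \<open>l1\<close> and \<open>l2\<close> place \<open>k\<close> itself in the central part,
  since an AP is non-empty by definition.\<close>

lemma is_AAPI:
  assumes k: "l1 \<in> U" "l2 \<in> U" "k \<in> U" "l1 + b \<le> k" "k + b \<le> l2"
    and diff: "\<And>x y. x \<in> U \<Longrightarrow> y \<in> U \<Longrightarrow> int d dvd int y - int x"
    and fill: "\<And>x l l'. l \<in> U \<Longrightarrow> l' \<in> U \<Longrightarrow> l + b \<le> x \<Longrightarrow> x + b \<le> l' \<Longrightarrow>
      int d dvd int x - int k \<Longrightarrow> x \<in> U"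
  shows "is_AAP U d b"
proof -
  have ne: "U \<noteq> {}" using k by auto
  define X where "X = {x \<in> U. Inf (enat ` U) + enat b \<le> enat x \<and> enat x + enat b \<le> Sup (enat ` U)}"
  have X: "X = {x \<in> U. (\<exists>l\<in>U. l + b \<le> x) \<and> (\<exists>l\<in>U. x + b \<le> l)}"
    unfolding X_def by (simp add: Inf_enat_add_le_iff[OF ne] le_Sup_enat_iff[OF ne])
  have "e = d" if "e \<in> set_of_distances X" for e
  proof -
    obtain x y where e: "1 \<le> e" "x \<in> X" "y \<in> X" "y - x = e"
      and gap: "\<not> (\<exists>m\<in>X. x < m \<and> m < y)"
      using \<open>e \<in> set_of_distances X\<close> unfolding set_of_distances_def by blast
    have xy: "int y - int x = int e" using e by auto
    moreover have "int d dvd int y - int x" using e diff by (auto simp: X)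
    ultimately have de: "d dvd e" by simp
    have "0 < d" using de e(1) by (auto intro: Nat.gr0I)
    obtain l l' where l: "l \<in> U" "l' \<in> U" "l + b \<le> x" "y + b \<le> l'" "x \<in> U"
      using e by (auto simp: X)
    have "\<not> d < e"
    proof
      assume "d < e"
      hence "x + d < y" using xy by linarith
      moreover have "int d dvd int (x + d) - int k"
        using diff[OF k(3) l(5)] by (metis add_diff_eq diff_add_eq dvd_add dvd_refl of_nat_add)
      ultimately have "x + d \<in> X"
        using fill[of l l' "x + d"] l \<open>x + d < y\<close> unfolding X
        by (simp, intro conjI bexI[of _ l] bexI[of _ l']) simp_all
      thus False using gap \<open>x + d < y\<close> \<open>0 < d\<close> by auto
    qed
    thus "e = d" using dvd_imp_le[OF de] e(1) by simp
  qed
  moreover have "k \<in> X" using k by (auto simp: X)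
  ultimately have "is_AP X d" by (auto simp: is_AP_def)
  moreover have "\<exists>z. int x = int k + int d * z" if "x \<in> U" for x
    using diff[OF k(3) that] by (metis add.commute diff_add_cancel dvdE)
  ultimately show ?thesis unfolding is_AAP_def X_def by blast
qed

section \<open>Additive symmetric sets of pairs in a cone\<close>

text \<open>
  The offset \<open>c\<close> cannot be dropped: in the monoid generated by \<open>u, v, w\<close> with the single relation
  \<open>2 u + w = 3 v + w\<close>, the elasticity \<open>3/2\<close> is not attained.
\<close>

locale length_pairs =
  fixes T :: "(nat \<times> nat) set" and p q c :: nat
  assumes add: "(k, l) \<in> T \<Longrightarrow> (k', l') \<in> T \<Longrightarrow> (k + k', l + l') \<in> T"
    and sym: "(k, l) \<in> T \<Longrightarrow> (l, k) \<in> T"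
    and zero: "(0, 0) \<in> T"
    and one: "(1, 1) \<in> T"
    and p: "0 < p"
    and bound: "(k, l) \<in> T \<Longrightarrow> p * l \<le> q * k"
    and ray: "(m * p + c, m * q + c) \<in> T"
begin

lemma multiple: "(k, l) \<in> T \<Longrightarrow> (m * k, m * l) \<in> T"
  by (induction m) (use add zero in auto)

lemma diagonal: "(k, k) \<in> T"
  using multiple[OF one, of k] by simp

text \<open>With slope 1 the cone condition, applied to a pair and to its mirror image, leaves only
  the diagonal.\<close>

lemma is_AAP_trivial:
  assumes "p = q"
  shows "is_AAP {l. (k, l) \<in> T} 1 0"
proof -
  have "l = k" if "(k, l) \<in> T" for k l
    using bound[OF that] bound[OF sym[OF that]] p assms by simp
  hence "{l. (k, l) \<in> T} = {k}" using diagonal by auto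
  thus ?thesis by (intro is_AAPI[where k = k]) auto
qed

text \<open>Minimality of \<open>d\<close> makes it divide every difference \<open>l - k\<close>,
  and \<open>key\<close> fills the cone above the diagonal up to a margin \<open>b\<close>. Symmetry
  carries this over to the part below the diagonal.\<close>

lemma is_AAP_nontrivial:
  assumes "p < q"
  shows "\<exists>d b. 1 \<le> d \<and> (\<exists>k0. \<forall>k\<ge>k0. is_AAP {l. (k, l) \<in> T} d b)"
proof -
  define D where "D d \<longleftrightarrow> 0 < d \<and> (\<exists>k. (k, k + d) \<in> T)" for d
  define d where "d = (LEAST d. D d)"
  \<comment> \<open>The ray point with \<open>m = 1\<close> has a positive difference, so a least
    one exists.\<close>
  have "D (q - p)"
    using ray[of 1] assms unfolding D_def by (auto intro!: exI[of _ "p + c"] simp: algebra_simps)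
  hence "D d" unfolding d_def by (rule LeastI)
  then obtain k1 where k1: "(k1, k1 + d) \<in> T" and d0: "0 < d" unfolding D_def by blast
  have "d dvd l - k" if kl: "(k, l) \<in> T" "k \<le> l" for k l
  proof (rule ccontr)
    assume *: "\<not> d dvd l - k"
    define r t where "r = (l - k) mod d" and "t = (l - k) div d"
    have l: "l = k + d * t + r" using kl(2) unfolding r_def t_def
      by (metis add.assoc le_add_diff_inverse mult_div_mod_eq)
    have r: "0 < r" "r < d" using * d0 by (auto simp: r_def dvd_eq_mod_eq_0)
    \<comment> \<open>Each copy of the mirrored pair \<open>(k1 + d, k1)\<close> lowers the
      difference by \<open>d\<close>; after \<open>t\<close> copies only the remainder
      \<open>r\<close> is left, against minimality.\<close>
    have "(k + t * (k1 + d), l + t * k1) \<in> T"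
      by (intro add kl multiple sym[OF k1])
    also have "l + t * k1 = k + t * (k1 + d) + r" by (simp add: l algebra_simps)
    finally have "D r" using r unfolding D_def by blast
    hence "d \<le> r" unfolding d_def by (rule Least_le)
    thus False using r by simp
  qed
  hence dvd: "int d dvd int l - int k" if "(k, l) \<in> T" for k l
    using that sym[OF that]
    by (metis dvd_diff_commute int_dvd_int_iff nat_le_linear of_nat_diff)
  have "d dvd q - p"
    using dvd[OF ray[of 1]] assms by (simp flip: of_nat_diff)
  then obtain s where s: "q - p = d * s" by blast
  have s0: "0 < s" using s assms by (auto intro: Nat.gr0I)
  \<comment> \<open>The margin reserves \<open>c\<close> for the offset of the ray and
    \<open>s * k1\<close> for fewer than \<open>s\<close> copies of \<open>(k1, k1 + d)\<close>. The
    factor \<open>q - p\<close> is the one cancelled when the lower bound for \<open>k\<close> is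
    derived.\<close>
  define b where "b = (q - p) * (c + s * k1)"
  have key: "(k, l) \<in> T" if kl: "k \<le> l" "d dvd l - k" "p * l + b \<le> q * k" for k l
  proof -
    obtain i where i: "l - k = d * i" using kl(2) by blast
    define t r where "t = i div s" and "r = i mod s"
    have i': "i = s * t + r" by (simp add: t_def r_def)
    have r: "r < s" using s0 by (simp add: r_def)
    have l: "l = k + t * (q - p) + r * d" using kl(1) i i' s by (simp add: algebra_simps)
    have q: "q = p + (q - p)" using assms by simp
    have "(q - p) * (t * p + (c + s * k1)) = p * (t * (q - p)) + b"
      by (simp add: b_def algebra_simps)
    also have "p * k + (p * (t * (q - p)) + b) \<le> p * l + b" by (simp add: l algebra_simps)
    also have "p * l + b \<le> p * k + (q - p) * k"
      using kl(3) by (subst (asm) q) (simp add: algebra_simps)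
    finally have "(q - p) * (t * p + (c + s * k1)) \<le> (q - p) * k" by simp
    hence "t * p + c + s * k1 \<le> k" using assms by simp
    moreover have "r * k1 \<le> s * k1" using r by simp
    ultimately obtain w where w: "k = t * p + c + r * k1 + w"
      by (metis add_le_mono1 le_trans nat_add_left_cancel_le nat_le_iff_add)
    have "t * q + c + r * (k1 + d) + w = l"
      unfolding l w by (subst q) (simp add: algebra_simps)
    moreover have "(t * p + c + r * k1 + w, t * q + c + r * (k1 + d) + w) \<in> T"
      by (intro add ray multiple k1 diagonal)
    ultimately show ?thesis using w by simp
  qed
  \<comment> \<open>Such a \<open>k\<close> leaves room for \<open>b\<close> copies of
    \<open>(k1, k1 + d)\<close> or of its mirror image, padded by the diagonal. This yields the
    members \<open>k + b * d\<close> and \<open>k - b * d\<close>, and \<open>0 < d\<close> makes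
    \<open>k\<close> central between them.\<close>
  have "is_AAP {l. (k, l) \<in> T} d b" if k: "b * (k1 + d) \<le> k" for k
  proof (rule is_AAPI[where k = k and ?l1.0 = "k - b * d" and ?l2.0 = "k + b * d"])
    obtain w where w: "k = b * (k1 + d) + w" using k by (metis le_iff_add)
    have "(b * k1 + (b * d + w), b * (k1 + d) + (b * d + w)) \<in> T"
      by (intro add multiple k1 diagonal)
    thus "k + b * d \<in> {l. (k, l) \<in> T}" by (simp add: w algebra_simps)
    have "(b * (k1 + d) + w, b * k1 + w) \<in> T"
      by (intro add multiple sym[OF k1] diagonal)
    thus "k - b * d \<in> {l. (k, l) \<in> T}" by (simp add: w algebra_simps)
    show "k \<in> {l. (k, l) \<in> T}" using diagonal by simp
    show "k - b * d + b \<le> k" "k + b \<le> k + b * d"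
      using d0 by (simp_all add: w algebra_simps)
    fix x y assume "x \<in> {l. (k, l) \<in> T}" "y \<in> {l. (k, l) \<in> T}"
    hence "int d dvd (int y - int k) - (int x - int k)" by (intro dvd_diff dvd) auto
    thus "int d dvd int y - int x" by simp
  next
    fix x l l' assume l: "l \<in> {l. (k, l) \<in> T}" "l' \<in> {l. (k, l) \<in> T}" "l + b \<le> x" "x + b \<le> l'"
      and x: "int d dvd int x - int k"
    show "x \<in> {l. (k, l) \<in> T}"
    proof (cases "k \<le> x")
      case True
      have "p * x + b \<le> p * x + p * b" using p by simp
      also have "\<dots> \<le> p * l'" using l(4) by (metis add_mult_distrib2 mult_le_mono2)
      also have "\<dots> \<le> q * k" using bound l by simp
      finally show ?thesis using key[OF True] x True by (simp flip: of_nat_diff)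
    next
      case False
      \<comment> \<open>Below the diagonal \<open>key\<close> is applied to the mirrored pair
        \<open>(x, k)\<close>; the cone condition of \<open>(l, k)\<close> supplies its
        margin.\<close>
      have "p * k + b \<le> q * l + b" using bound[OF sym] l by simp
      also have "\<dots> \<le> q * l + q * b" using assms by simp
      also have "\<dots> \<le> q * x" using l(3) by (metis add_mult_distrib2 mult_le_mono2)
      finally have "(x, k) \<in> T"
        using key[of x k] x False by (simp add: dvd_diff_commute flip: of_nat_diff)
      thus ?thesis using sym by simp
    qed
  qed
  thus ?thesis using d0 by (intro exI[of _ d] exI[of _ b]) auto
qed

lemma is_AAP: "\<exists>d b. 1 \<le> d \<and> (\<exists>k0. \<forall>k\<ge>k0. is_AAP {l. (k, l) \<in> T} d b)"
proof -
  have "p \<le> q" using bound[OF one] by simp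
  thus ?thesis using is_AAP_nontrivial is_AAP_trivial by (cases "p = q") fastforce+
qed

end

section \<open>Unit-cancellative congruences on free commutative monoids\<close>

text \<open>Induction on the letters: a subsequence that is increasing in the other letters is
  thinned until the multiplicity of \<open>a\<close> is monotone. A decreasing sequence of naturals
  is constant once it reaches its least value, so in either case a tail is increasing.\<close>

lemma multiset_chain:
  assumes "finite A" "\<And>n. set_mset (f n) \<subseteq> A"
  shows "\<exists>r :: nat \<Rightarrow> nat. strict_mono r \<and> (\<forall>i j. i \<le> j \<longrightarrow> f (r i) \<subseteq># f (r j))"
  using assms
proof (induction A arbitrary: f)
  case empty
  thus ?case by (intro exI[of _ id]) (auto simp: strict_mono_def)
next
  case (insert a A)
  define g where "g n = filter_mset (\<lambda>x. x \<noteq> a) (f n)" for n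
  have "set_mset (g n) \<subseteq> A" for n using insert.prems[of n] by (auto simp: g_def)
  then obtain r :: "nat \<Rightarrow> nat" where r: "strict_mono r" "\<And>i j. i \<le> j \<Longrightarrow> g (r i) \<subseteq># g (r j)"
    using insert.IH[of g] by blast
  obtain s :: "nat \<Rightarrow> nat" where s: "strict_mono s" "monoseq (\<lambda>n. count (f (r (s n))) a)"
    using seq_monosub[of "\<lambda>n. count (f (r n)) a"] by auto
  define h where "h n = count (f (r (s n))) a" for n
  obtain N where N: "\<And>i j. N \<le> i \<Longrightarrow> i \<le> j \<Longrightarrow> h i \<le> h j"
  proof (cases "incseq h")
    case True
    thus ?thesis using that[of 0] by (auto simp: incseq_def)
  next
    case False
    hence dec: "decseq h" using s(2) by (simp add: monoseq_iff h_def[abs_def])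
    obtain N where N: "h N = (LEAST m. m \<in> range h)"
      using LeastI[of "\<lambda>m. m \<in> range h" "h 0"] by (metis rangeE rangeI)
    have "h i \<le> h j" if "N \<le> i" for i j
    proof -
      have "h i \<le> h N" using dec that by (simp add: decseqD)
      also have "\<dots> \<le> h j" unfolding N by (rule Least_le) simp
      finally show ?thesis .
    qed
    thus ?thesis using that by blast
  qed
  have "strict_mono (\<lambda>n. r (s (N + n)))"
    using r(1) s(1) by (auto simp: strict_mono_def)
  moreover have "f (r (s (N + i))) \<subseteq># f (r (s (N + j)))" if "i \<le> j" for i j
  proof (rule mset_subset_eqI)
    fix x
    show "count (f (r (s (N + i)))) x \<le> count (f (r (s (N + j)))) x"
    proof (cases "x = a")
      case True
      thus ?thesis using N[of "N + i" "N + j"] that by (simp add: h_def)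
    next
      case False
      have "s (N + i) \<le> s (N + j)" using that s(1) by (simp add: strict_mono_less_eq)
      from mset_subset_eq_count[OF r(2)[OF this], of x] False show ?thesis by (simp add: g_def)
    qed
  qed
  ultimately show ?case by blast
qed

text \<open>\<open>B\<close> consists of the minimal pairs; descent on the total size finds one
  below every pair. If there were infinitely many, chains extracted in the first and then in the
  second component would give two comparable ones, which minimality makes equal.\<close>

lemma dickson_multiset_pairs:
  fixes S :: "('i multiset \<times> 'i multiset) set"
  assumes A: "finite A" and S: "\<And>x y. (x, y) \<in> S \<Longrightarrow> set_mset x \<subseteq> A \<and> set_mset y \<subseteq> A"
  shows "\<exists>B\<subseteq>S. finite B \<and> (\<forall>(x, y)\<in>S. \<exists>(x', y')\<in>B. x' \<subseteq># x \<and> y' \<subseteq># y)"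
proof -
  define B where "B = {(x, y) \<in> S. \<forall>(x', y')\<in>S. x' \<subseteq># x \<longrightarrow> y' \<subseteq># y \<longrightarrow> x' = x \<and> y' = y}"
  have "\<exists>(x', y')\<in>B. x' \<subseteq># x \<and> y' \<subseteq># y" if "(x, y) \<in> S" for x y
    using that
  proof (induction "size x + size y" arbitrary: x y rule: less_induct)
    case less
    show ?case
    proof (cases "(x, y) \<in> B")
      case True
      thus ?thesis by auto
    next
      case False
      then obtain x' y' where *: "(x', y') \<in> S" "x' \<subseteq># x" "y' \<subseteq># y" "x' \<noteq> x \<or> y' \<noteq> y"
        using less.prems unfolding B_def by auto
      have "size x' \<le> size x" "size y' \<le> size y" using * by (auto intro: size_mset_mono)
      moreover have "size x' < size x \<or> size y' < size y"
        using * by (metis mset_subset_size subset_mset.le_neq_trans)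
      ultimately have "size x' + size y' < size x + size y" by linarith
      from less.hyps[OF this *(1)] obtain x'' y'' where
        "(x'', y'') \<in> B" "x'' \<subseteq># x'" "y'' \<subseteq># y'" by auto
      thus ?thesis using * by (blast intro: subset_mset.order_trans)
    qed
  qed
  moreover have "finite B"
  proof (rule ccontr)
    assume "infinite B"
    then obtain f :: "nat \<Rightarrow> 'i multiset \<times> 'i multiset" where f: "inj f" "range f \<subseteq> B"
      using infinite_countable_subset by blast
    have "B \<subseteq> S" by (auto simp: B_def)
    hence fS: "f n \<in> S" for n using f(2) by blast
    have "set_mset (fst (f n)) \<subseteq> A" "set_mset (snd (f n)) \<subseteq> A" for n
      using S fS[of n] by (metis prod.collapse)+
    then obtain r s :: "nat \<Rightarrow> nat" where
      r: "strict_mono r" "\<And>i j. i \<le> j \<Longrightarrow> fst (f (r i)) \<subseteq># fst (f (r j))" and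
      s: "strict_mono s" "\<And>i j. i \<le> j \<Longrightarrow> snd (f (r (s i))) \<subseteq># snd (f (r (s j)))"
      using multiset_chain[OF A, of "\<lambda>n. fst (f n)"]
        multiset_chain[OF A, of "\<lambda>n. snd (f (r n))" for r] by metis
    have s01: "s 0 < s 1" using s(1) by (simp add: strict_mono_less)
    have "fst (f (r (s 0))) \<subseteq># fst (f (r (s 1)))" "snd (f (r (s 0))) \<subseteq># snd (f (r (s 1)))"
      using r(2) s(2) s01 by auto
    moreover have "f (r (s 1)) \<in> B" using f by auto
    ultimately have "f (r (s 0)) = f (r (s 1))"
      using fS[of "r (s 0)"] unfolding B_def by (auto simp: case_prod_beta prod_eq_iff)
    hence "r (s 0) = r (s 1)" using f(1) by (auto dest: injD)
    moreover have "r (s 0) < r (s 1)" using r(1) s01 by (simp add: strict_mono_less)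
    ultimately show False by simp
  qed
  moreover have "B \<subseteq> S" by (auto simp: B_def)
  ultimately show ?thesis by (intro exI[of _ B]) auto
qed

section \<open>The congruence, its cancellative hull and the maximal ratio\<close>

text \<open>Multisets over \<open>A\<close> form the free commutative monoid on the atoms, and
  \<open>rel\<close> is a congruence on it, reflexive only there. The axiom
  \<open>unit_cancel\<close> is the abstract form of direct finiteness.\<close>

locale factorization_relation =
  fixes A :: "'i set" and rel :: "'i multiset \<Rightarrow> 'i multiset \<Rightarrow> bool"
  assumes finite_atoms: "finite A" and atoms: "A \<noteq> {}"
    and rel_atoms: "rel x y \<Longrightarrow> set_mset x \<subseteq> A"
    and rel_refl: "set_mset x \<subseteq> A \<Longrightarrow> rel x x"
    and rel_sym: "rel x y \<Longrightarrow> rel y x"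
    and rel_trans: "rel x y \<Longrightarrow> rel y z \<Longrightarrow> rel x z"
    and rel_add: "rel x y \<Longrightarrow> rel x' y' \<Longrightarrow> rel (x + x') (y + y')"
    and unit_cancel: "rel x (x + y) \<Longrightarrow> y = {#}"
begin

text \<open>The congruence that defines the cancellative quotient.\<close>

definition crel :: "'i multiset \<Rightarrow> 'i multiset \<Rightarrow> bool" where
  "crel x y \<longleftrightarrow> (\<exists>z. rel (x + z) (y + z))"

lemma crel_atoms: "crel x y \<Longrightarrow> set_mset x \<subseteq> A \<and> set_mset y \<subseteq> A"
  unfolding crel_def using rel_atoms rel_sym by fastforce

text \<open>Unit cancellation survives in the cancellative quotient because the auxiliary summand
  \<open>z\<close> can take the place of \<open>x\<close> in \<open>unit_cancel\<close>.\<close>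

lemma crel_empty: "crel {#} y \<Longrightarrow> y = {#}"
  unfolding crel_def using unit_cancel by (metis add.commute add_0)

text \<open>Adding the first relation to the reversed second one leaves the two differences with the
  common summand \<open>x' + y' + z + z'\<close>. This closure under differences is the gain from
  passing to \<open>crel\<close>.\<close>

lemma crel_diff:
  assumes "crel x y" "crel x' y'" "x' \<subseteq># x" "y' \<subseteq># y"
  shows "crel (x - x') (y - y')"
proof -
  obtain z z' where z: "rel (x + z) (y + z)" "rel (x' + z') (y' + z')"
    using assms(1,2) unfolding crel_def by blast
  have "rel ((x + z) + (y' + z')) ((y + z) + (x' + z'))"
    using z rel_add rel_sym by blast
  moreover have "(x + z) + (y' + z') = (x - x') + (x' + y' + z + z')"
    "(y + z) + (x' + z') = (y - y') + (x' + y' + z + z')"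
    using assms(3,4) by (auto simp: subset_mset.le_iff_add ac_simps)
  ultimately show ?thesis unfolding crel_def by metis
qed

text \<open>The maximum is taken over the finite set \<open>B\<close> of minimal pairs; all other
  pairs are sums of these, and a mediant never exceeds the larger ratio.\<close>

lemma exists_maximal_ratio:
  "\<exists>x y. crel x y \<and> x \<noteq> {#} \<and> (\<forall>x' y'. crel x' y' \<longrightarrow> size x * size y' \<le> size y * size x')"
proof -
  define S where "S = {(x, y). crel x y \<and> x \<noteq> {#}}"
  obtain B where B: "B \<subseteq> S" "finite B"
    and dom: "\<forall>(x, y)\<in>S. \<exists>(x', y')\<in>B. x' \<subseteq># x \<and> y' \<subseteq># y"
    using dickson_multiset_pairs[OF finite_atoms, of S] crel_atoms
    unfolding S_def by (metis (no_types, lifting) case_prodD mem_Collect_eq)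
  obtain a where "a \<in> A" using atoms by blast
  hence "crel {#a#} {#a#}" unfolding crel_def using rel_refl[of "{#a#}"]
    by (intro exI[of _ "{#}"]) auto
  hence "({#a#}, {#a#}) \<in> S" by (simp add: S_def)
  hence "B \<noteq> {}" using dom by fastforce
  define ratio where "ratio = (\<lambda>(x :: 'i multiset, y :: 'i multiset). rat_of_nat (size y) / rat_of_nat (size x))"
  have "Max (ratio ` B) \<in> ratio ` B" using B(2) \<open>B \<noteq> {}\<close> by simp
  then obtain xy where xy: "xy \<in> B" "Max (ratio ` B) = ratio xy" by blast
  obtain x y where xy_eq: "xy = (x, y)" by fastforce
  have x: "crel x y" "x \<noteq> {#}" using xy B(1) by (auto simp: S_def xy_eq)
  have max: "size x * size v \<le> size y * size u" if "(u, v) \<in> B" for u v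
  proof -
    have u: "u \<noteq> {#}" using that B(1) by (auto simp: S_def)
    have "ratio (u, v) \<le> ratio (x, y)" using Max_ge[of "ratio ` B"] B(2) that xy xy_eq by auto
    hence "rat_of_nat (size v) * rat_of_nat (size x) \<le> rat_of_nat (size y) * rat_of_nat (size u)"
      using u x(2) nonempty_has_size[of u] nonempty_has_size[of x] by (simp add: ratio_def field_simps)
    thus ?thesis by (simp flip: of_nat_mult add: mult.commute)
  qed
  \<comment> \<open>In product form the inequality is additive in \<open>(u, v)\<close>. A pair of
    \<open>B\<close> is split off, and since its first entry is non-empty the rest is smaller; the
    descent ends at \<open>u = {#}\<close>, where \<open>crel_empty\<close> forces
    \<open>v = {#}\<close>.\<close>
  have "size x * size v \<le> size y * size u" if "crel u v" for u v
    using that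
  proof (induction "size u" arbitrary: u v rule: less_induct)
    case less
    show ?case
    proof (cases "u = {#}")
      case True
      thus ?thesis using crel_empty less.prems by auto
    next
      case False
      hence "(u, v) \<in> S" using less.prems by (simp add: S_def)
      then obtain u' v' where uv: "(u', v') \<in> B" "u' \<subseteq># u" "v' \<subseteq># v" using dom by blast
      have u': "crel u' v'" "u' \<noteq> {#}" using uv(1) B(1) by (auto simp: S_def)
      obtain s t where st: "u = u' + s" "v = v' + t"
        using uv(2,3) by (auto simp: subset_mset.le_iff_add)
      have "crel s t" using crel_diff[OF less.prems u'(1) uv(2,3)] by (simp add: st)
      moreover have "size s < size u" using u'(2) by (simp add: st nonempty_has_size)
      ultimately have "size x * size t \<le> size y * size s" using less.hyps by blast
      thus ?thesis using max[OF uv(1)] by (simp add: st algebra_simps)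
    qed
  qed
  thus ?thesis using x by blast
qed

text \<open>A pair \<open>u\<close>, \<open>v\<close> of maximal ratio bounds the cone of length
  pairs, and the multiset \<open>z\<close> witnessing \<open>crel u v\<close> provides the offset of
  the ray.\<close>

theorem is_AAP_lengths:
  "\<exists>d b. 1 \<le> d \<and> (\<exists>k0. \<forall>k\<ge>k0. is_AAP {l. \<exists>x y. rel x y \<and> size x = k \<and> size y = l} d b)"
proof -
  define T where "T = {(size x, size y) | x y. rel x y}"
  obtain u v where uv: "crel u v" "u \<noteq> {#}"
    and max: "\<And>x y. crel x y \<Longrightarrow> size u * size y \<le> size v * size x"
    using exists_maximal_ratio by blast
  obtain z where z: "rel (u + z) (v + z)" using uv(1) unfolding crel_def by blast
  have zA: "set_mset z \<subseteq> A" using rel_atoms[OF z] by simp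
  \<comment> \<open>One \<open>z\<close> serves all \<open>m\<close>: with it present, a single
    \<open>u\<close> is exchanged for \<open>v\<close>, and the remaining copies are exchanged by
    the induction hypothesis.\<close>
  have ray: "rel (repeat_mset m u + z) (repeat_mset m v + z)" for m
  proof (induction m)
    case 0
    show ?case using rel_refl[OF zA] by simp
  next
    case (Suc m)
    have "rel u u" "rel v v" using crel_atoms[OF uv(1)] rel_refl by auto
    hence "rel (repeat_mset m u) (repeat_mset m u)"
      using rel_add rel_refl[of "{#}"] by (induction m) auto
    hence "rel (repeat_mset m u + (u + z)) (repeat_mset m u + (v + z))"
      using z by (rule rel_add)
    moreover have "rel (v + (repeat_mset m u + z)) (v + (repeat_mset m v + z))"
      using \<open>rel v v\<close> Suc.IH by (rule rel_add)
    ultimately show ?case using rel_trans by (simp add: ac_simps)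
  qed
  have "length_pairs T (size u) (size v) (size z)"
  proof
    fix k l k' l' assume "(k, l) \<in> T" "(k', l') \<in> T"
    thus "(k + k', l + l') \<in> T" unfolding T_def using rel_add by (fastforce simp flip: size_union)
  next
    fix k l assume "(k, l) \<in> T"
    thus "(l, k) \<in> T" unfolding T_def using rel_sym by auto
  next
    show "(0, 0) \<in> T" unfolding T_def using rel_refl[of "{#}"] by force
  next
    obtain a where "a \<in> A" using atoms by blast
    thus "(1, 1) \<in> T" unfolding T_def using rel_refl[of "{#a#}"] by force
  next
    show "0 < size u" using uv(2) by (simp add: nonempty_has_size)
  next
    fix k l assume "(k, l) \<in> T"
    then obtain x y where "rel x y" "k = size x" "l = size y" by (auto simp: T_def)
    moreover from this have "crel x y" unfolding crel_def by (metis add.right_neutral)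
    ultimately show "size u * l \<le> size v * k" using max by simp
  next
    fix m show "(m * size u + size z, m * size v + size z) \<in> T"
      unfolding T_def using ray[of m] by force
  qed
  from length_pairs.is_AAP[OF this] show ?thesis
    unfolding T_def by (simp add: conj_ac eq_commute)
qed

end

section \<open>Direct sums and isomorphisms\<close>

lemma left_module_direct_sum:
  assumes "left_module R M" "left_module R N"
  shows "left_module R (direct_sum M N)"
proof -
  interpret M: left_module R M by fact
  interpret N: left_module R N by fact
  have "abelian_group (direct_sum M N)"
  proof (rule abelian_groupI)
    fix x assume "x \<in> carrier (direct_sum M N)"
    thus "\<exists>y\<in>carrier (direct_sum M N). y \<oplus>\<^bsub>direct_sum M N\<^esub> x = \<zero>\<^bsub>direct_sum M N\<^esub>"
      by (intro bexI[of _ "(\<ominus>\<^bsub>M\<^esub> fst x, \<ominus>\<^bsub>N\<^esub> snd x)"])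
        (auto simp: direct_sum_def M.M.l_neg N.M.l_neg)
  qed (auto simp: direct_sum_def M.M.a_ac N.M.a_ac)
  thus ?thesis
    by (auto intro!: left_module.intro left_module_axioms.intro M.R.ring_axioms simp: direct_sum_def
        M.smult_closed M.smult_l_distr M.smult_r_distr M.smult_assoc1 M.smult_one
        N.smult_closed N.smult_l_distr N.smult_r_distr N.smult_assoc1 N.smult_one)
qed

lemma left_module_finite_direct_sum:
  assumes "ring R" and F: "\<And>i. i < k \<Longrightarrow> left_module R (F i)"
  shows "left_module R (finite_direct_sum k F)"
proof -
  note F' = left_module.axioms(2)[OF F]
  note ag = abelian_groupE[OF F']
  let ?S = "finite_direct_sum k F"
  have S: "x \<in> carrier ?S \<longleftrightarrow> x \<in> extensional {..<k} \<and> (\<forall>i<k. x i \<in> carrier (F i))" for x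
    by (auto simp: finite_direct_sum_def PiE_iff)
  \<comment> \<open>Extensionality reduces each module axiom to the components below
    \<open>k\<close>.\<close>
  have eq: "x = y" if "x \<in> carrier ?S" "y \<in> carrier ?S" "\<And>i. i < k \<Longrightarrow> x i = y i" for x y
    using that by (auto simp: S intro: extensionalityI[of _ "{..<k}"])
  have comp: "(x \<oplus>\<^bsub>?S\<^esub> y) i = x i \<oplus>\<^bsub>F i\<^esub> y i" "(a \<odot>\<^bsub>?S\<^esub> x) i = a \<odot>\<^bsub>F i\<^esub> x i" "\<zero>\<^bsub>?S\<^esub> i = \<zero>\<^bsub>F i\<^esub>"
    if "i < k" for x y a i
    using that by (simp_all add: finite_direct_sum_def)
  have ext: "(x \<oplus>\<^bsub>?S\<^esub> y) \<in> extensional {..<k}" "(a \<odot>\<^bsub>?S\<^esub> x) \<in> extensional {..<k}" "\<zero>\<^bsub>?S\<^esub> \<in> extensional {..<k}" for x y a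
    by (simp_all add: finite_direct_sum_def)
  have add: "x \<oplus>\<^bsub>?S\<^esub> y \<in> carrier ?S" if "x \<in> carrier ?S" "y \<in> carrier ?S" for x y
    using that ag(1) by (simp add: S ext comp)
  have smult: "a \<odot>\<^bsub>?S\<^esub> x \<in> carrier ?S" if "a \<in> carrier R" "x \<in> carrier ?S" for a x
    using that left_module.smult_closed[OF F] by (simp add: S ext comp)
  have zero: "\<zero>\<^bsub>?S\<^esub> \<in> carrier ?S"
    using ag(2) by (simp add: S ext comp)
  note closed = add smult zero
  have "abelian_group ?S"
  proof (rule abelian_groupI)
    fix x assume x: "x \<in> carrier ?S"
    define y where "y = (\<lambda>i\<in>{..<k}. \<ominus>\<^bsub>F i\<^esub> x i)"
    have y: "y \<in> carrier ?S"
      using x abelian_group.a_inv_closed[OF F'] by (simp add: S y_def)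
    moreover have "y \<oplus>\<^bsub>?S\<^esub> x = \<zero>\<^bsub>?S\<^esub>"
      by (rule eq) (use x y abelian_group.l_neg[OF F'] in \<open>auto simp: closed comp, auto simp: S y_def\<close>)
    ultimately show "\<exists>y\<in>carrier ?S. y \<oplus>\<^bsub>?S\<^esub> x = \<zero>\<^bsub>?S\<^esub>" by blast
  next
    fix x y z assume "x \<in> carrier ?S" "y \<in> carrier ?S" "z \<in> carrier ?S"
    thus "x \<oplus>\<^bsub>?S\<^esub> y \<oplus>\<^bsub>?S\<^esub> z = x \<oplus>\<^bsub>?S\<^esub> (y \<oplus>\<^bsub>?S\<^esub> z)"
      by (intro eq) (auto simp: closed comp, auto simp: S ag(3))
  next
    fix x y assume "x \<in> carrier ?S" "y \<in> carrier ?S"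
    thus "x \<oplus>\<^bsub>?S\<^esub> y = y \<oplus>\<^bsub>?S\<^esub> x"
      by (intro eq) (auto simp: closed comp, auto simp: S ag(4))
  next
    fix x assume "x \<in> carrier ?S"
    thus "\<zero>\<^bsub>?S\<^esub> \<oplus>\<^bsub>?S\<^esub> x = x"
      by (intro eq) (auto simp: closed comp, auto simp: S ag(5))
  qed (rule closed; assumption?)+
  moreover have "left_module_axioms R ?S"
  proof
    fix a b x assume *: "a \<in> carrier R" "b \<in> carrier R" "x \<in> carrier ?S"
    have ab: "a \<oplus>\<^bsub>R\<^esub> b \<in> carrier R" "a \<otimes>\<^bsub>R\<^esub> b \<in> carrier R"
      using * by (simp_all add: ring.ring_simprules[OF assms(1)])
    show "(a \<oplus>\<^bsub>R\<^esub> b) \<odot>\<^bsub>?S\<^esub> x = a \<odot>\<^bsub>?S\<^esub> x \<oplus>\<^bsub>?S\<^esub> b \<odot>\<^bsub>?S\<^esub> x"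
      by (rule eq) (use * ab in \<open>auto simp: closed comp, auto simp: S left_module.smult_l_distr[OF F]\<close>)
    show "(a \<otimes>\<^bsub>R\<^esub> b) \<odot>\<^bsub>?S\<^esub> x = a \<odot>\<^bsub>?S\<^esub> (b \<odot>\<^bsub>?S\<^esub> x)"
      by (rule eq) (use * ab in \<open>auto simp: closed comp, auto simp: S left_module.smult_assoc1[OF F]\<close>)
  next
    fix a x y assume *: "a \<in> carrier R" "x \<in> carrier ?S" "y \<in> carrier ?S"
    show "a \<odot>\<^bsub>?S\<^esub> (x \<oplus>\<^bsub>?S\<^esub> y) = a \<odot>\<^bsub>?S\<^esub> x \<oplus>\<^bsub>?S\<^esub> a \<odot>\<^bsub>?S\<^esub> y"
      by (rule eq) (use * in \<open>auto simp: closed comp, auto simp: S left_module.smult_r_distr[OF F]\<close>)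
  next
    fix x assume *: "x \<in> carrier ?S"
    show "\<one>\<^bsub>R\<^esub> \<odot>\<^bsub>?S\<^esub> x = x"
      by (rule eq) (use * ring.ring_simprules(6)[OF assms(1)] in
        \<open>auto simp: closed comp, auto simp: S left_module.smult_one[OF F]\<close>)
  qed (rule closed)
  ultimately show ?thesis using assms(1) by (intro left_module.intro)
qed

section \<open>Isomorphisms and their compatibility with direct sums\<close>

lemma module_isoE:
  assumes "module_iso R M N"
  obtains f where "bij_betw f (carrier M) (carrier N)"
    "\<And>x y. x \<in> carrier M \<Longrightarrow> y \<in> carrier M \<Longrightarrow> f (x \<oplus>\<^bsub>M\<^esub> y) = f x \<oplus>\<^bsub>N\<^esub> f y"
    "\<And>a x. a \<in> carrier R \<Longrightarrow> x \<in> carrier M \<Longrightarrow> f (a \<odot>\<^bsub>M\<^esub> x) = a \<odot>\<^bsub>N\<^esub> f x"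
  using assms unfolding module_iso_def by blast

lemma module_isoI:
  assumes "bij_betw f (carrier M) (carrier N)"
    "\<And>x y. x \<in> carrier M \<Longrightarrow> y \<in> carrier M \<Longrightarrow> f (x \<oplus>\<^bsub>M\<^esub> y) = f x \<oplus>\<^bsub>N\<^esub> f y"
    "\<And>a x. a \<in> carrier R \<Longrightarrow> x \<in> carrier M \<Longrightarrow> f (a \<odot>\<^bsub>M\<^esub> x) = a \<odot>\<^bsub>N\<^esub> f x"
  shows "module_iso R M N"
  using assms unfolding module_iso_def by blast

lemma module_iso_refl: "module_iso R M M"
  by (rule module_isoI[of id]) auto

lemma module_iso_sym:
  assumes "left_module R M" "module_iso R M N"
  shows "module_iso R N M"
proof -
  interpret M: left_module R M by fact
  from assms(2) show ?thesis
  proof (rule module_isoE)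
    fix f assume f: "bij_betw f (carrier M) (carrier N)"
      "\<And>x y. x \<in> carrier M \<Longrightarrow> y \<in> carrier M \<Longrightarrow> f (x \<oplus>\<^bsub>M\<^esub> y) = f x \<oplus>\<^bsub>N\<^esub> f y"
      "\<And>a x. a \<in> carrier R \<Longrightarrow> x \<in> carrier M \<Longrightarrow> f (a \<odot>\<^bsub>M\<^esub> x) = a \<odot>\<^bsub>N\<^esub> f x"
    define g where "g = inv_into (carrier M) f"
    have g: "bij_betw g (carrier N) (carrier M)"
      unfolding g_def using f(1) by (rule bij_betw_inv_into)
    have gN: "g u \<in> carrier M" "f (g u) = u" if "u \<in> carrier N" for u
      using that g bij_betw_inv_into_right[OF f(1)] by (auto simp: g_def bij_betw_def)
    have gf: "g (f x) = x" if "x \<in> carrier M" for x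
      using that bij_betw_inv_into_left[OF f(1)] by (simp add: g_def)
    show ?thesis
    proof (rule module_isoI[OF g])
      fix u v assume uv: "u \<in> carrier N" "v \<in> carrier N"
      show "g (u \<oplus>\<^bsub>N\<^esub> v) = g u \<oplus>\<^bsub>M\<^esub> g v"
        using f(2)[OF gN(1)[OF uv(1)] gN(1)[OF uv(2)]] gN(2)[OF uv(1)] gN(2)[OF uv(2)]
          gf[OF M.M.a_closed[OF gN(1)[OF uv(1)] gN(1)[OF uv(2)]]] by simp
    next
      fix a u assume au: "a \<in> carrier R" "u \<in> carrier N"
      show "g (a \<odot>\<^bsub>N\<^esub> u) = a \<odot>\<^bsub>M\<^esub> g u"
        using f(3)[OF au(1) gN(1)[OF au(2)]] gN(2)[OF au(2)]
          gf[OF M.smult_closed[OF au(1) gN(1)[OF au(2)]]] by simp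
    qed
  qed
qed

lemma module_iso_trans:
  assumes "module_iso R M N" "module_iso R N P"
  shows "module_iso R M P"
proof -
  obtain f where f: "bij_betw f (carrier M) (carrier N)"
    "\<And>x y. x \<in> carrier M \<Longrightarrow> y \<in> carrier M \<Longrightarrow> f (x \<oplus>\<^bsub>M\<^esub> y) = f x \<oplus>\<^bsub>N\<^esub> f y"
    "\<And>a x. a \<in> carrier R \<Longrightarrow> x \<in> carrier M \<Longrightarrow> f (a \<odot>\<^bsub>M\<^esub> x) = a \<odot>\<^bsub>N\<^esub> f x"
    using assms(1) by (rule module_isoE) blast
  obtain g where g: "bij_betw g (carrier N) (carrier P)"
    "\<And>x y. x \<in> carrier N \<Longrightarrow> y \<in> carrier N \<Longrightarrow> g (x \<oplus>\<^bsub>N\<^esub> y) = g x \<oplus>\<^bsub>P\<^esub> g y"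
    "\<And>a x. a \<in> carrier R \<Longrightarrow> x \<in> carrier N \<Longrightarrow> g (a \<odot>\<^bsub>N\<^esub> x) = a \<odot>\<^bsub>P\<^esub> g x"
    using assms(2) by (rule module_isoE) blast
  have "f x \<in> carrier N" if "x \<in> carrier M" for x
    using f(1) that by (auto simp: bij_betw_def)
  with f g show ?thesis
    by (intro module_isoI[of "g \<circ> f"] bij_betw_trans[OF f(1) g(1)]) auto
qed

lemma direct_sum_cong:
  assumes "module_iso R M M'" "module_iso R N N'"
  shows "module_iso R (direct_sum M N) (direct_sum M' N')"
proof -
  obtain f where f: "bij_betw f (carrier M) (carrier M')"
    "\<And>x y. x \<in> carrier M \<Longrightarrow> y \<in> carrier M \<Longrightarrow> f (x \<oplus>\<^bsub>M\<^esub> y) = f x \<oplus>\<^bsub>M'\<^esub> f y"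
    "\<And>a x. a \<in> carrier R \<Longrightarrow> x \<in> carrier M \<Longrightarrow> f (a \<odot>\<^bsub>M\<^esub> x) = a \<odot>\<^bsub>M'\<^esub> f x"
    using assms(1) by (rule module_isoE) blast
  obtain g where g: "bij_betw g (carrier N) (carrier N')"
    "\<And>x y. x \<in> carrier N \<Longrightarrow> y \<in> carrier N \<Longrightarrow> g (x \<oplus>\<^bsub>N\<^esub> y) = g x \<oplus>\<^bsub>N'\<^esub> g y"
    "\<And>a x. a \<in> carrier R \<Longrightarrow> x \<in> carrier N \<Longrightarrow> g (a \<odot>\<^bsub>N\<^esub> x) = a \<odot>\<^bsub>N'\<^esub> g x"
    using assms(2) by (rule module_isoE) blast
  show ?thesis
  proof (rule module_isoI[of "map_prod f g"])
    show "bij_betw (map_prod f g) (carrier (direct_sum M N)) (carrier (direct_sum M' N'))"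
      using bij_betw_map_prod[OF f(1) g(1)] by (simp add: direct_sum_def)
  qed (auto simp: direct_sum_def f g)
qed

text \<open>This covers at once the reordering of summands and their replacement by isomorphic
  ones.\<close>

lemma finite_direct_sum_cong:
  assumes \<pi>: "bij_betw \<pi> {..<k} {..<l}"
    and iso: "\<And>i. i < k \<Longrightarrow> module_iso R (F i) (G (\<pi> i))"
  shows "module_iso R (finite_direct_sum k F) (finite_direct_sum l G)"
proof -
  have "\<forall>i\<in>{..<k}. \<exists>f. bij_betw f (carrier (F i)) (carrier (G (\<pi> i))) \<and>
    (\<forall>x\<in>carrier (F i). \<forall>y\<in>carrier (F i). f (x \<oplus>\<^bsub>F i\<^esub> y) = f x \<oplus>\<^bsub>G (\<pi> i)\<^esub> f y) \<and>
    (\<forall>a\<in>carrier R. \<forall>x\<in>carrier (F i). f (a \<odot>\<^bsub>F i\<^esub> x) = a \<odot>\<^bsub>G (\<pi> i)\<^esub> f x)"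
    using iso unfolding module_iso_def by blast
  from bchoice[OF this] obtain f where f': "\<forall>i\<in>{..<k}. bij_betw (f i) (carrier (F i)) (carrier (G (\<pi> i))) \<and>
    (\<forall>x\<in>carrier (F i). \<forall>y\<in>carrier (F i). f i (x \<oplus>\<^bsub>F i\<^esub> y) = f i x \<oplus>\<^bsub>G (\<pi> i)\<^esub> f i y) \<and>
    (\<forall>a\<in>carrier R. \<forall>x\<in>carrier (F i). f i (a \<odot>\<^bsub>F i\<^esub> x) = a \<odot>\<^bsub>G (\<pi> i)\<^esub> f i x)"
    by blast
  have f: "bij_betw (f i) (carrier (F i)) (carrier (G (\<pi> i)))" if "i < k" for i
    using f' that by simp
  have add: "f i (x \<oplus>\<^bsub>F i\<^esub> y) = f i x \<oplus>\<^bsub>G (\<pi> i)\<^esub> f i y"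
    if "i < k" "x \<in> carrier (F i)" "y \<in> carrier (F i)" for i x y
    using f' that by simp
  have smult: "f i (a \<odot>\<^bsub>F i\<^esub> x) = a \<odot>\<^bsub>G (\<pi> i)\<^esub> f i x"
    if "i < k" "a \<in> carrier R" "x \<in> carrier (F i)" for i a x
    using f' that by simp
  define h where "h = inv_into {..<k} \<pi>"
  have h: "h j < k" "\<pi> (h j) = j" if "j < l" for j
    using that \<pi> bij_betw_inv_into_right[OF \<pi>] bij_betw_inv_into[OF \<pi>]
    by (auto simp: h_def bij_betw_def)
  have \<pi>': "\<pi> i < l" "h (\<pi> i) = i" if "i < k" for i
    using that \<pi> bij_betw_inv_into_left[OF \<pi>] by (auto simp: h_def bij_betw_def)
  \<comment> \<open>\<open>\<Theta>\<close> carries component \<open>h j\<close> to position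
    \<open>j\<close> by means of \<open>f (h j)\<close>, and \<open>\<Psi>\<close> goes back. Both
    results are \<open>undefined\<close> outside the index set, as the carriers demand.\<close>
  define \<Theta> where "\<Theta> x = (\<lambda>j\<in>{..<l}. f (h j) (x (h j)))" for x
  define \<Psi> where "\<Psi> y = (\<lambda>i\<in>{..<k}. inv_into (carrier (F i)) (f i) (y (\<pi> i)))" for y
  show ?thesis
  proof (rule module_isoI[of \<Theta>])
    show "bij_betw \<Theta> (carrier (finite_direct_sum k F)) (carrier (finite_direct_sum l G))"
    proof (rule bij_betw_byWitness[of _ \<Psi>])
      show "\<forall>x\<in>carrier (finite_direct_sum k F). \<Psi> (\<Theta> x) = x"
      proof
        fix x assume x: "x \<in> carrier (finite_direct_sum k F)"
        have "\<Psi> (\<Theta> x) i = x i" for i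
          using x bij_betw_inv_into_left[OF f, of i "x i"]
          by (cases "i < k") (auto simp: \<Psi>_def \<Theta>_def \<pi>' finite_direct_sum_def PiE_iff extensional_def)
        thus "\<Psi> (\<Theta> x) = x" by (rule ext)
      qed
      show "\<forall>y\<in>carrier (finite_direct_sum l G). \<Theta> (\<Psi> y) = y"
      proof
        fix y assume y: "y \<in> carrier (finite_direct_sum l G)"
        have "\<Theta> (\<Psi> y) j = y j" for j
          using y bij_betw_inv_into_right[OF f, of "h j" "y j"]
          by (cases "j < l") (auto simp: \<Psi>_def \<Theta>_def h finite_direct_sum_def PiE_iff extensional_def)
        thus "\<Theta> (\<Psi> y) = y" by (rule ext)
      qed
      show "\<Theta> ` carrier (finite_direct_sum k F) \<subseteq> carrier (finite_direct_sum l G)"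
      proof (rule image_subsetI)
        fix x assume x: "x \<in> carrier (finite_direct_sum k F)"
        have "f (h j) (x (h j)) \<in> carrier (G j)" if "j < l" for j
          using bij_betw_apply[OF f[OF h(1)], OF that, of "x (h j)"] x h[OF that]
          by (simp add: finite_direct_sum_def PiE_iff)
        thus "\<Theta> x \<in> carrier (finite_direct_sum l G)"
          by (simp add: \<Theta>_def finite_direct_sum_def PiE_iff)
      qed
      show "\<Psi> ` carrier (finite_direct_sum l G) \<subseteq> carrier (finite_direct_sum k F)"
      proof (rule image_subsetI)
        fix y assume y: "y \<in> carrier (finite_direct_sum l G)"
        have "inv_into (carrier (F i)) (f i) (y (\<pi> i)) \<in> carrier (F i)" if "i < k" for i
          using bij_betw_apply[OF bij_betw_inv_into[OF f[OF that]], of "y (\<pi> i)"] y \<pi>'(1)[OF that]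
          by (simp add: finite_direct_sum_def PiE_iff)
        thus "\<Psi> y \<in> carrier (finite_direct_sum k F)"
          by (simp add: \<Psi>_def finite_direct_sum_def PiE_iff)
      qed
    qed
  qed (simp_all add: \<Theta>_def finite_direct_sum_def restrict_def fun_eq_iff PiE_iff h add smult)
qed

lemma finite_direct_sum_add:
  fixes F :: "nat \<Rightarrow> ('a, 'b) module"
  shows "module_iso R (finite_direct_sum (k + l) F)
     (direct_sum (finite_direct_sum k F) (finite_direct_sum l (\<lambda>i. F (k + i))))"
    (is "module_iso R ?S (direct_sum ?S1 ?S2)")
proof -
  define \<Theta> :: "(nat \<Rightarrow> 'b) \<Rightarrow> (nat \<Rightarrow> 'b) \<times> (nat \<Rightarrow> 'b)"
    where "\<Theta> x = (\<lambda>i\<in>{..<k}. x i, \<lambda>i\<in>{..<l}. x (k + i))" for x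
  define \<Psi> :: "(nat \<Rightarrow> 'b) \<times> (nat \<Rightarrow> 'b) \<Rightarrow> nat \<Rightarrow> 'b"
    where "\<Psi> y = (\<lambda>i\<in>{..<k + l}. if i < k then fst y i else snd y (i - k))" for y
  have S: "x \<in> carrier ?S \<longleftrightarrow> x \<in> extensional {..<k + l} \<and> (\<forall>i<k + l. x i \<in> carrier (F i))" for x
    by (auto simp: finite_direct_sum_def PiE_iff)
  have S': "y \<in> carrier (direct_sum ?S1 ?S2) \<longleftrightarrow>
      fst y \<in> extensional {..<k} \<and> (\<forall>i<k. fst y i \<in> carrier (F i)) \<and>
      snd y \<in> extensional {..<l} \<and> (\<forall>i<l. snd y i \<in> carrier (F (k + i)))" for y
    by (auto simp: direct_sum_def finite_direct_sum_def PiE_iff mem_Times_iff)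
  show ?thesis
  proof (rule module_isoI[of \<Theta>])
    show "bij_betw \<Theta> (carrier ?S) (carrier (direct_sum ?S1 ?S2))"
    proof (rule bij_betw_byWitness[of _ \<Psi>])
      show "\<forall>x\<in>carrier ?S. \<Psi> (\<Theta> x) = x"
      proof
        fix x assume "x \<in> carrier ?S"
        thus "\<Psi> (\<Theta> x) = x"
          by (intro extensionalityI[of _ "{..<k + l}"]) (auto simp: S \<Psi>_def \<Theta>_def)
      qed
      show "\<forall>y\<in>carrier (direct_sum ?S1 ?S2). \<Theta> (\<Psi> y) = y"
      proof
        fix y assume "y \<in> carrier (direct_sum ?S1 ?S2)"
        hence "fst y \<in> extensional {..<k}" "snd y \<in> extensional {..<l}"
          unfolding S' by blast+
        hence "fst (\<Theta> (\<Psi> y)) = fst y" "snd (\<Theta> (\<Psi> y)) = snd y"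
          by (simp_all add: \<Psi>_def \<Theta>_def fun_eq_iff extensional_def)
        thus "\<Theta> (\<Psi> y) = y" by (rule prod_eqI)
      qed
      show "\<Theta> ` carrier ?S \<subseteq> carrier (direct_sum ?S1 ?S2)"
        by (auto simp: S S' \<Theta>_def)
      show "\<Psi> ` carrier (direct_sum ?S1 ?S2) \<subseteq> carrier ?S"
      proof (rule image_subsetI)
        fix y assume y: "y \<in> carrier (direct_sum ?S1 ?S2)"
        have "snd y (i - k) \<in> carrier (F i)" if "\<not> i < k" "i < k + l" for i
        proof -
          have i: "k + (i - k) = i" "i - k < l" using that by auto
          have "\<forall>j<l. snd y j \<in> carrier (F (k + j))" using y unfolding S' by blast
          hence "snd y (i - k) \<in> carrier (F (k + (i - k)))" using i(2) by blast
          thus ?thesis by (simp only: i(1))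
        qed
        thus "\<Psi> y \<in> carrier ?S" using y by (auto simp: S S' \<Psi>_def)
      qed
    qed
  qed (simp_all add: \<Theta>_def finite_direct_sum_def direct_sum_def restrict_def fun_eq_iff)
qed

section \<open>Direct sums of lists of modules\<close>

abbreviation (input) list_sum :: "('a, 'b) module list \<Rightarrow> ('a, nat \<Rightarrow> 'b) module" where
  "list_sum Fs \<equiv> finite_direct_sum (length Fs) ((!) Fs)"

lemma list_sum_append:
  assumes R: "ring R" and F: "\<And>M. M \<in> set Fs \<union> set Gs \<Longrightarrow> left_module R M"
  shows "module_iso R (list_sum (Fs @ Gs)) (direct_sum (list_sum Fs) (list_sum Gs))"
proof -
  let ?F = "(!) (Fs @ Gs)"
  have "module_iso R (finite_direct_sum (length Fs) ?F) (list_sum Fs)"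
    by (rule finite_direct_sum_cong[of id]) (auto simp: nth_append module_iso_refl)
  moreover have "module_iso R (finite_direct_sum (length Gs) (\<lambda>i. ?F (length Fs + i))) (list_sum Gs)"
    by (rule finite_direct_sum_cong[of id]) (auto simp: nth_append module_iso_refl)
  ultimately show ?thesis
    using module_iso_trans[OF finite_direct_sum_add direct_sum_cong] by fastforce
qed

text \<open>Replacing component 0 of the zero element by a non-zero \<open>u\<close> gives a second
  element of the sum.\<close>

lemma zero_module_list_sum_imp_Nil:
  assumes M: "zero_module M" "module_iso R M (list_sum Fs)"
    and F: "\<And>N. N \<in> set Fs \<Longrightarrow> left_module R N \<and> \<not> zero_module N"
  shows "Fs = []"
proof (rule ccontr)
  assume "Fs \<noteq> []"
  have carrier_Fs: "\<zero>\<^bsub>Fs ! i\<^esub> \<in> carrier (Fs ! i)" if "i < length Fs" for i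
    using F[OF nth_mem[OF that]] abelian_groupE(2)[OF left_module.axioms(2)] by blast
  obtain u where u: "u \<in> carrier (Fs ! 0)" "u \<noteq> \<zero>\<^bsub>Fs ! 0\<^esub>"
    using F[OF nth_mem[of 0 Fs]] carrier_Fs[of 0] \<open>Fs \<noteq> []\<close> by (auto simp: zero_module_def)
  obtain f where "bij_betw f (carrier M) (carrier (list_sum Fs))"
    using M(2) by (rule module_isoE)
  then obtain z where z: "carrier (list_sum Fs) = {z}"
    using M(1) by (auto simp: zero_module_def bij_betw_def)
  define x where "x = \<zero>\<^bsub>list_sum Fs\<^esub>"
  have "x \<in> carrier (list_sum Fs)" "x(0 := u) \<in> carrier (list_sum Fs)"
    using carrier_Fs u(1) \<open>Fs \<noteq> []\<close>
    by (auto simp: x_def finite_direct_sum_def PiE_iff extensional_def)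
  hence "x(0 := u) = x" using z by simp
  hence "x 0 = u" by (metis fun_upd_same)
  thus False using u(2) \<open>Fs \<noteq> []\<close> by (simp add: x_def finite_direct_sum_def)
qed

section \<open>Classes of directly finite modules\<close>

locale module_class =
  fixes R :: "('a, 'r) ring_scheme" and C :: "('a, 'b) module set"
  assumes ring: "ring R"
    and modules: "M \<in> C \<Longrightarrow> left_module R M"
    and sums: "closed_under_finite_direct_sums R C"
    and summands: "closed_under_direct_summands R C"
    and directly_finite: "M \<in> C \<Longrightarrow> directly_finite R M"
begin

definition indecs :: "('a, 'b) module set" where
  "indecs = {M \<in> C. indecomposable R M}"

text \<open>These are the factorizations of the class of \<open>M\<close> into atoms. Recording
  classes instead of modules identifies isomorphic summands but keeps their multiplicity.\<close>

definition decomposes :: "('a, 'b) module \<Rightarrow> ('a, 'b) module set multiset \<Rightarrow> bool" where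
  "decomposes M x \<longleftrightarrow> (\<exists>Fs. set Fs \<subseteq> indecs \<and> mset (map (iso_class R C) Fs) = x \<and>
     module_iso R M (list_sum Fs))"

text \<open>This is the kernel congruence of the factorization homomorphism from the free
  commutative monoid on the atoms to \<open>V_monoid R C\<close>.\<close>

definition same_sum :: "('a, 'b) module set multiset \<Rightarrow> ('a, 'b) module set multiset \<Rightarrow> bool" where
  "same_sum x y \<longleftrightarrow> (\<exists>M\<in>C. decomposes M x \<and> decomposes M y)"

lemma iso_class_eqD:
  assumes "M \<in> C" "N \<in> C" "iso_class R C M = iso_class R C N"
  shows "module_iso R M N"
proof -
  have "M \<in> iso_class R C M" using assms(1) module_iso_refl by (auto simp: iso_class_def)
  thus ?thesis using assms(3) by (auto simp: iso_class_def)
qed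

lemma left_module_list_sum: "set Fs \<subseteq> C \<Longrightarrow> left_module R (list_sum Fs)"
  by (rule left_module_finite_direct_sum[OF ring]) (meson modules nth_mem subsetD)

text \<open>Equality of the multisets yields a bijection of positions that matches isomorphic
  modules.\<close>

lemma list_sum_mset_cong:
  assumes "set Fs \<subseteq> C" "set Gs \<subseteq> C"
    and "mset (map (iso_class R C) Fs) = mset (map (iso_class R C) Gs)"
  shows "module_iso R (list_sum Fs) (list_sum Gs)"
proof -
  obtain \<pi> where \<pi>: "bij_betw \<pi> {..<length Fs} {..<length Gs}"
    "\<And>i. i < length Fs \<Longrightarrow> map (iso_class R C) Fs ! i = map (iso_class R C) Gs ! \<pi> i"
    using permutation_Ex_bij[OF assms(3)] by auto
  show ?thesis
  proof (rule finite_direct_sum_cong[OF \<pi>(1)])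
    fix i assume i: "i < length Fs"
    hence "\<pi> i < length Gs" using \<pi>(1) by (auto simp: bij_betw_def)
    hence "iso_class R C (Fs ! i) = iso_class R C (Gs ! \<pi> i)" "Fs ! i \<in> C" "Gs ! \<pi> i \<in> C"
      using \<pi>(2)[OF i] nth_mem[OF i] nth_mem[of "\<pi> i" Gs] i assms(1,2) by auto
    thus "module_iso R (Fs ! i) (Gs ! \<pi> i)" by (intro iso_class_eqD)
  qed
qed

lemma list_sum_in_class:
  assumes "set Fs \<subseteq> C"
  obtains P where "P \<in> C" "module_iso R P (list_sum Fs)"
proof -
  have "\<forall>i<length Fs. Fs ! i \<in> C" using assms nth_mem by blast
  hence "\<exists>P\<in>C. module_iso R P (list_sum Fs)"
    using sums unfolding closed_under_finite_direct_sums_def by blast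
  thus ?thesis using that by blast
qed

lemma indecs_subset: "indecs \<subseteq> C"
  by (auto simp: indecs_def)

lemma indecs_nonzero: "M \<in> indecs \<Longrightarrow> left_module R M \<and> \<not> zero_module M"
  by (simp add: indecs_def indecomposable_def)

lemma lift_multiset:
  assumes "set_mset x \<subseteq> iso_class R C ` indecs"
  obtains Fs where "set Fs \<subseteq> indecs" "mset (map (iso_class R C) Fs) = x"
  using assms
proof (induction x arbitrary: thesis)
  case empty
  show ?case by (rule empty.prems(1)[of "[]"]) auto
next
  case (add a x)
  obtain Fs where Fs: "set Fs \<subseteq> indecs" "mset (map (iso_class R C) Fs) = x"
    using add.IH add.prems(2) by auto
  obtain M where "M \<in> indecs" "a = iso_class R C M" using add.prems(2) by auto
  thus ?case using Fs by (intro add.prems(1)[of "M # Fs"]) auto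
qed

lemma decomposes_atoms: "decomposes M x \<Longrightarrow> set_mset x \<subseteq> iso_class R C ` indecs"
  unfolding decomposes_def by (auto simp: subset_iff)

lemma decomposes_unique:
  assumes "M \<in> C" "N \<in> C" "decomposes M x" "decomposes N x"
  shows "module_iso R M N"
proof -
  obtain Fs Gs where F: "set Fs \<subseteq> indecs" "mset (map (iso_class R C) Fs) = x"
    "module_iso R M (list_sum Fs)" and G: "set Gs \<subseteq> indecs"
    "mset (map (iso_class R C) Gs) = x" "module_iso R N (list_sum Gs)"
    using assms unfolding decomposes_def by blast
  have "module_iso R (list_sum Fs) (list_sum Gs)"
    using F(1,2) G(1,2) indecs_subset by (intro list_sum_mset_cong) auto
  from module_iso_trans[OF F(3) module_iso_trans[OF this module_iso_sym[OF modules[OF assms(2)] G(3)]]]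
  show ?thesis .
qed

lemma decomposes_cong:
  assumes "M \<in> C" "module_iso R M N" "decomposes M x"
  shows "decomposes N x"
  using module_iso_trans[OF module_iso_sym[OF modules[OF assms(1)] assms(2)]] assms(3)
  unfolding decomposes_def by blast

lemma decomposes_zero:
  assumes "zero_module M" "decomposes M x"
  shows "x = {#}"
proof -
  obtain Fs where Fs: "set Fs \<subseteq> indecs" "mset (map (iso_class R C) Fs) = x"
    "module_iso R M (list_sum Fs)"
    using assms(2) unfolding decomposes_def by blast
  have "Fs = []"
    by (rule zero_module_list_sum_imp_Nil[OF assms(1) Fs(3)]) (use Fs(1) indecs_nonzero in blast)
  thus ?thesis using Fs(2) by simp
qed

lemma decomposes_add:
  assumes "decomposes M x" "decomposes N y" "M \<in> C" "N \<in> C" "P \<in> C" "module_iso R P (direct_sum M N)"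
  shows "decomposes P (x + y)"
proof -
  obtain Fs Gs where F: "set Fs \<subseteq> indecs" "mset (map (iso_class R C) Fs) = x"
    "module_iso R M (list_sum Fs)" and G: "set Gs \<subseteq> indecs"
    "mset (map (iso_class R C) Gs) = y" "module_iso R N (list_sum Gs)"
    using assms unfolding decomposes_def by blast
  have "left_module R (list_sum (Fs @ Gs))"
    using F(1) G(1) indecs_subset by (intro left_module_list_sum) auto
  moreover have "module_iso R (list_sum (Fs @ Gs)) (direct_sum (list_sum Fs) (list_sum Gs))"
    by (rule list_sum_append[OF ring]) (use F(1) G(1) indecs_nonzero in blast)
  ultimately have "module_iso R (direct_sum (list_sum Fs) (list_sum Gs)) (list_sum (Fs @ Gs))"
    by (rule module_iso_sym)
  from module_iso_trans[OF assms(6) module_iso_trans[OF direct_sum_cong[OF F(3) G(3)] this]]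
  have "module_iso R P (list_sum (Fs @ Gs))" .
  moreover have "set (Fs @ Gs) \<subseteq> indecs" "mset (map (iso_class R C) (Fs @ Gs)) = x + y"
    using F G by auto
  ultimately show ?thesis unfolding decomposes_def by blast
qed

text \<open>The closure assumption concerns \<open>finite_direct_sum\<close>, so it is applied to
  the concatenated lists of indecomposable summands.\<close>

lemma direct_sum_in_class:
  assumes "decomposes M x" "decomposes N y" "M \<in> C" "N \<in> C"
  obtains P where "P \<in> C" "module_iso R P (direct_sum M N)"
proof -
  obtain Fs Gs where F: "set Fs \<subseteq> indecs" "module_iso R M (list_sum Fs)"
    and G: "set Gs \<subseteq> indecs" "module_iso R N (list_sum Gs)"
    using assms unfolding decomposes_def by blast
  obtain P where P: "P \<in> C" "module_iso R P (list_sum (Fs @ Gs))"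
    by (rule list_sum_in_class[of "Fs @ Gs"]) (use F(1) G(1) indecs_subset in auto)
  have "module_iso R (list_sum (Fs @ Gs)) (direct_sum (list_sum Fs) (list_sum Gs))"
    by (rule list_sum_append[OF ring]) (use F(1) G(1) indecs_nonzero in blast)
  moreover have "module_iso R (direct_sum (list_sum Fs) (list_sum Gs)) (direct_sum M N)"
    by (rule module_iso_sym[OF left_module_direct_sum[OF modules modules] direct_sum_cong])
      (fact assms(3,4) F(2) G(2))+
  ultimately have "module_iso R P (direct_sum M N)"
    by (rule module_iso_trans[OF P(2) module_iso_trans])
  thus ?thesis using that P(1) by blast
qed

lemma decomposes_ex:
  assumes "set_mset x \<subseteq> iso_class R C ` indecs"
  obtains M where "M \<in> C" "decomposes M x"
proof -
  obtain Fs where Fs: "set Fs \<subseteq> indecs" "mset (map (iso_class R C) Fs) = x"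
    using assms by (rule lift_multiset)
  obtain P where "P \<in> C" "module_iso R P (list_sum Fs)"
    by (rule list_sum_in_class[of Fs]) (use Fs(1) indecs_subset in auto)
  thus ?thesis using that Fs unfolding decomposes_def by blast
qed

text \<open>Transitivity rests on \<open>decomposes_unique\<close>. Direct finiteness gives the last
  axiom: if \<open>M\<close> decomposes as \<open>x\<close> and as \<open>x + y\<close>, and
  \<open>N\<close> as \<open>y\<close>, then \<open>M\<close> is isomorphic to
  \<open>direct_sum M N\<close>, so \<open>N\<close> is zero and \<open>y\<close> is empty.\<close>

lemma factorization_relation_same_sum:
  assumes "finite (iso_class R C ` indecs)" "indecs \<noteq> {}"
  shows "factorization_relation (iso_class R C ` indecs) same_sum"
proof
  show "finite (iso_class R C ` indecs)" "iso_class R C ` indecs \<noteq> {}"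
    using assms by auto
next
  fix x y assume "same_sum x y"
  then obtain M where M: "M \<in> C" "decomposes M x" "decomposes M y"
    unfolding same_sum_def by blast
  show "set_mset x \<subseteq> iso_class R C ` indecs" by (rule decomposes_atoms[OF M(2)])
  show "same_sum y x" unfolding same_sum_def using M by blast
next
  fix x assume "set_mset x \<subseteq> iso_class R C ` indecs"
  then obtain M where "M \<in> C" "decomposes M x" by (rule decomposes_ex)
  thus "same_sum x x" unfolding same_sum_def by blast
next
  fix x y z assume "same_sum x y" "same_sum y z"
  then obtain M N where M: "M \<in> C" "decomposes M x" "decomposes M y"
    and N: "N \<in> C" "decomposes N y" "decomposes N z"
    unfolding same_sum_def by blast
  have "decomposes M z"
    by (rule decomposes_cong[OF N(1) decomposes_unique[OF N(1) M(1) N(2) M(3)] N(3)])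
  thus "same_sum x z" unfolding same_sum_def using M by blast
next
  fix x y x' y' assume "same_sum x y" "same_sum x' y'"
  then obtain M N where MN: "M \<in> C" "N \<in> C" "decomposes M x" "decomposes M y"
    "decomposes N x'" "decomposes N y'"
    unfolding same_sum_def by blast
  obtain P where P: "P \<in> C" "module_iso R P (direct_sum M N)"
    by (rule direct_sum_in_class[OF MN(3,5,1,2)])
  have "decomposes P (x + x')"
    by (rule decomposes_add[OF MN(3,5,1,2) P])
  moreover have "decomposes P (y + y')"
    by (rule decomposes_add[OF MN(4,6,1,2) P])
  ultimately show "same_sum (x + x') (y + y')" unfolding same_sum_def using P(1) by blast
next
  fix x y assume xy: "same_sum x (x + y)"
  then obtain M where M: "M \<in> C" "decomposes M x" "decomposes M (x + y)"
    unfolding same_sum_def by blast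
  have "set_mset y \<subseteq> iso_class R C ` indecs"
    using decomposes_atoms[OF M(3)] by simp
  then obtain N where N: "N \<in> C" "decomposes N y" by (rule decomposes_ex)
  obtain P where P: "P \<in> C" "module_iso R P (direct_sum M N)"
    by (rule direct_sum_in_class[OF M(2) N(2) M(1) N(1)])
  have "decomposes P (x + y)" by (rule decomposes_add[OF M(2) N(2) M(1) N(1) P])
  from module_iso_trans[OF decomposes_unique[OF M(1) P(1) M(3) this] P(2)]
  have "module_iso R M (direct_sum M N)" .
  hence "zero_module N"
    using directly_finite[OF M(1)] modules[OF N(1)] unfolding directly_finite_def by blast
  thus "y = {#}" using decomposes_zero N(2) by blast
qed

section \<open>Sets of lengths and their unions in terms of \<open>same_sum\<close>\<close>

text \<open>A transposition moves summand \<open>j\<close> to position 0, the case already settled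
  by \<open>summand_of_finite_direct_sum_mem\<close>.\<close>

lemma summand_in_class:
  assumes "M \<in> C" "\<And>i. i < k \<Longrightarrow> left_module R (F i)" "module_iso R M (finite_direct_sum k F)" "j < k"
  shows "F j \<in> C"
proof -
  let ?t = "transpose 0 j"
  have t: "?t i < k" if "i < k" for i using that assms(4) by (auto simp: transpose_def)
  have "bij_betw ?t {..<k} {..<k}"
    using t by (intro bij_betw_byWitness[of _ ?t]) auto
  hence "module_iso R (finite_direct_sum k F) (finite_direct_sum k (F \<circ> ?t))"
    by (rule finite_direct_sum_cong) (simp add: module_iso_refl)
  from module_iso_trans[OF assms(3) this]
  have iso: "module_iso R M (finite_direct_sum k (F \<circ> ?t))" .
  have "\<forall>i<k. left_module R ((F \<circ> ?t) i)" using assms(2) t by simp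
  hence "(F \<circ> ?t) 0 \<in> C"
    by (rule summand_of_finite_direct_sum_mem[OF summands assms(1) modules[OF assms(1)] _ _ iso])
      (use assms(4) in simp)
  thus ?thesis by simp
qed

text \<open>The definition of \<open>set_of_lengths\<close> does not ask the indecomposable summands
  to lie in \<open>C\<close>; closure under direct summands puts them there.\<close>

lemma decomposes_iff:
  assumes "M \<in> C"
  shows "(\<exists>x. decomposes M x \<and> size x = k) \<longleftrightarrow>
    (\<exists>F :: nat \<Rightarrow> ('a, 'b) module. (\<forall>i<k. indecomposable R (F i)) \<and>
      module_iso R M (finite_direct_sum k F))" (is "?L \<longleftrightarrow> ?R")
proof
  assume ?L
  then obtain Fs where "set Fs \<subseteq> indecs" "length Fs = k" "module_iso R M (list_sum Fs)"
    unfolding decomposes_def by auto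
  moreover from this have "indecomposable R (Fs ! i)" if "i < k" for i
    using nth_mem[of i Fs] that unfolding indecs_def by blast
  ultimately show ?R by (intro exI[of _ "(!) Fs"]) simp
next
  assume ?R
  then obtain F :: "nat \<Rightarrow> ('a, 'b) module" where
    F: "\<And>i. i < k \<Longrightarrow> indecomposable R (F i)" "module_iso R M (finite_direct_sum k F)"
    by blast
  define Fs where "Fs = map F [0..<k]"
  have "F i \<in> indecs" if "i < k" for i
    using summand_in_class[OF assms _ F(2) that] F(1) that
    unfolding indecs_def indecomposable_def by blast
  hence "set Fs \<subseteq> indecs" by (auto simp: Fs_def)
  moreover have "module_iso R (finite_direct_sum k F) (list_sum Fs)"
    by (rule finite_direct_sum_cong[of id]) (auto simp: Fs_def module_iso_refl)
  hence "module_iso R M (list_sum Fs)" by (rule module_iso_trans[OF F(2)])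
  ultimately have "decomposes M (mset (map (iso_class R C) Fs))"
    unfolding decomposes_def by blast
  moreover have "size (mset (map (iso_class R C) Fs)) = k" by (simp add: Fs_def)
  ultimately show ?L by blast
qed

text \<open>A decomposition of positive size rules out the class of zero modules, whose set of
  lengths is fixed separately as \<open>{0}\<close>.\<close>

lemma mem_set_of_lengths_iff:
  assumes M: "M \<in> C" and k: "1 \<le> k"
  shows "k \<in> set_of_lengths R C (iso_class R C M) \<longleftrightarrow> (\<exists>x. decomposes M x \<and> size x = k)"
proof
  assume "k \<in> set_of_lengths R C (iso_class R C M)"
  then obtain N where N: "N \<in> C" "module_iso R N M" and "\<exists>F :: nat \<Rightarrow> ('a, 'b) module.
      (\<forall>i<k. indecomposable R (F i)) \<and> module_iso R N (finite_direct_sum k F)"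
    using k by (auto simp: set_of_lengths_def iso_class_def split: if_splits)
  then obtain x where "decomposes N x" "size x = k" using decomposes_iff[OF N(1)] by blast
  thus "\<exists>x. decomposes M x \<and> size x = k" using decomposes_cong[OF N] by blast
next
  assume *: "\<exists>x. decomposes M x \<and> size x = k"
  hence "\<not> zero_module M" using decomposes_zero k by fastforce
  moreover have "M \<in> iso_class R C M" using M module_iso_refl by (auto simp: iso_class_def)
  ultimately show "k \<in> set_of_lengths R C (iso_class R C M)"
    using * k decomposes_iff[OF M, of k] unfolding set_of_lengths_def V_monoid_def by auto
qed

lemma zero_notin_set_of_lengths:
  assumes "k \<in> L" "1 \<le> k" "L \<in> system_of_sets_of_lengths R C" "l \<in> L"
  shows "1 \<le> l"
  using assms by (auto simp: system_of_sets_of_lengths_def set_of_lengths_def split: if_splits)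

lemma union_of_sets_of_lengths_eq:
  assumes "carrier (V_monoid R C) \<noteq> {\<one>\<^bsub>V_monoid R C\<^esub>}" and k: "1 \<le> k"
    and cancel: "\<And>y. same_sum {#} y \<Longrightarrow> y = {#}"
  shows "union_of_sets_of_lengths R C k = {l. \<exists>x y. same_sum x y \<and> size x = k \<and> size y = l}"
proof (intro equalityI subsetI)
  fix l assume "l \<in> union_of_sets_of_lengths R C k"
  then obtain L where L: "L \<in> system_of_sets_of_lengths R C" "k \<in> L" "l \<in> L"
    using assms(1) by (auto simp: union_of_sets_of_lengths_def)
  have l: "1 \<le> l" by (rule zero_notin_set_of_lengths[OF L(2) k L(1,3)])
  obtain M where "M \<in> C" "L = set_of_lengths R C (iso_class R C M)"
    using L(1) by (auto simp: system_of_sets_of_lengths_def V_monoid_def)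
  thus "l \<in> {l. \<exists>x y. same_sum x y \<and> size x = k \<and> size y = l}"
    using L(2,3) mem_set_of_lengths_iff k l unfolding same_sum_def by blast
next
  fix l assume "l \<in> {l. \<exists>x y. same_sum x y \<and> size x = k \<and> size y = l}"
  then obtain x y M where *: "same_sum x y" "M \<in> C" "decomposes M x" "decomposes M y"
      "size x = k" "size y = l"
    unfolding same_sum_def by blast
  \<comment> \<open>The description of lengths by decompositions holds for positive lengths, so
    \<open>l = 0\<close> has to be excluded; \<open>cancel\<close> does so for the reversed
    pair.\<close>
  have "y \<noteq> {#}"
  proof
    assume "y = {#}"
    hence "same_sum {#} x" using * unfolding same_sum_def by blast
    thus False using cancel[of x] *(5) k by simp
  qed
  hence "1 \<le> l" using *(6) by (simp add: Suc_le_eq nonempty_has_size)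
  hence "{k, l} \<subseteq> set_of_lengths R C (iso_class R C M)"
    using mem_set_of_lengths_iff[OF *(2)] * k by blast
  moreover have "set_of_lengths R C (iso_class R C M) \<in> system_of_sets_of_lengths R C"
    using *(2) by (auto simp: system_of_sets_of_lengths_def V_monoid_def)
  ultimately show "l \<in> union_of_sets_of_lengths R C k"
    using assms(1) by (auto simp: union_of_sets_of_lengths_def)
qed

lemma V_monoid_trivial:
  assumes "\<And>M. M \<in> C \<Longrightarrow> zero_module M"
  shows "carrier (V_monoid R C) = {\<one>\<^bsub>V_monoid R C\<^esub>}"
proof -
  have "module_iso R M N" if MN: "M \<in> C" "N \<in> C" for M N
  proof -
    interpret M: left_module R M by (rule modules[OF MN(1)])
    interpret N: left_module R N by (rule modules[OF MN(2)])
    have "carrier M = {\<zero>\<^bsub>M\<^esub>}" "carrier N = {\<zero>\<^bsub>N\<^esub>}"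
      using assms MN by (auto simp: zero_module_def)
    thus ?thesis using M.smult_closed[of _ "\<zero>\<^bsub>M\<^esub>"] N.smult_closed[of _ "\<zero>\<^bsub>N\<^esub>"]
      by (intro module_isoI[of "\<lambda>_. \<zero>\<^bsub>N\<^esub>"]) (auto simp: bij_betw_def)
  qed
  hence "iso_class R C M = \<one>\<^bsub>V_monoid R C\<^esub>" if "M \<in> C" for M
    using that assms by (auto simp: iso_class_def V_monoid_def)
  \<comment> \<open>The empty direct sum provides a member of \<open>C\<close>, so the carrier is
    not empty.\<close>
  moreover obtain P where "P \<in> C" using list_sum_in_class[of "[]"] by auto
  ultimately show ?thesis by (auto simp: V_monoid_def)
qed

end

theorem corollary3p9:
  fixes R :: "('a, 'r) ring_scheme" and C :: "('a, 'b) module set"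
  assumes "ring R"
    and "\<forall>M\<in>C. left_module R M"
    and "closed_under_finite_direct_sums R C"
    and "closed_under_direct_summands R C"
    and "closed_under_isomorphisms R C"
    and "\<forall>M\<in>C. directly_finite R M"
    and "finite {iso_class R C M | M. M \<in> C \<and> indecomposable R M}"
    and "(\<exists>M\<in>C. \<not> zero_module M) \<longrightarrow> (\<exists>M\<in>C. indecomposable R M)"
  shows "structure_theorem_for_unions R C"
proof -
  interpret module_class R C by (rule module_class.intro) (use assms in blast)+
  show ?thesis
  proof (cases "carrier (V_monoid R C) = {\<one>\<^bsub>V_monoid R C\<^esub>}")
    case True
    \<comment> \<open>For a trivial monoid the unions are singletons by convention.\<close>
    have "is_AAP {k} 1 0" for k by (rule is_AAPI[where k = k]) auto
    thus ?thesis using True unfolding structure_theorem_for_unions_def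
      by (intro exI[of _ 1] exI[of _ 0]) (simp add: union_of_sets_of_lengths_def)
  next
    case False
    have indecs_eq: "iso_class R C ` indecs = {iso_class R C M | M. M \<in> C \<and> indecomposable R M}"
      by (auto simp: indecs_def)
    \<comment> \<open>A non-trivial monoid comes from a non-zero module, and the last assumption
      then supplies the atom that \<open>factorization_relation\<close> requires.\<close>
    have "\<exists>M\<in>C. \<not> zero_module M" using False V_monoid_trivial by blast
    hence "indecs \<noteq> {}" using assms(8) unfolding indecs_def by blast
    then interpret factorization_relation "iso_class R C ` indecs" same_sum
      by (rule factorization_relation_same_sum[OF assms(7)[folded indecs_eq]])
    have "union_of_sets_of_lengths R C k = {l. \<exists>x y. same_sum x y \<and> size x = k \<and> size y = l}"
      if "1 \<le> k" for k
      by (rule union_of_sets_of_lengths_eq[OF False that]) (simp add: unit_cancel[of "{#}"])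
    moreover obtain d b k0 where "1 \<le> d"
      "\<forall>k\<ge>k0. is_AAP {l. \<exists>x y. same_sum x y \<and> size x = k \<and> size y = l} d b"
      using is_AAP_lengths by blast
    ultimately show ?thesis unfolding structure_theorem_for_unions_def
      by (intro exI[of _ d] exI[of _ b]) auto
  qed
qed

end
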